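(* Let $\lambda\in\mathbb{R}\setminus\{-1,0\}$ and let $T\in\mathcal{B}(\mathcal{H})$ be self-adjoint with generic part $T_0$ on $\mathcal{H}_0$ with respect to $\lambda$. Suppose $\mathcal{H}_0=\mathcal{K}\oplus\mathcal{K}$ and $T_0-\frac{1+\lambda}{2}I=B\oplus(-B)$ with $B\in\mathcal{B}(\mathcal{K})$ positive and $\frac{|1-|\lambda||}{2}I<B<\frac{1+|\lambda|}{2}I$. If $\lambda=1$, then with respect to $\mathcal{H}=\mathcal{N}(T)\oplus\mathcal{N}(T-I)\oplus\mathcal{N}(T-2I)\oplus\mathcal{H}_0$, $$W^*(\mathcal{T}_\lambda)=\mathbb{C}I\oplus\mathcal{B}(\mathcal{N}(T-I))\oplus\mathbb{C}I\oplus M_2(\{B\}'),\quad (W^*(\mathcal{T}_\lambda))'=\mathcal{B}(\mathcal{N}(T))\oplus\mathbb{C}I\oplus\mathcal{B}(\mathcal{N}(T-2I))\oplus W^*(B)^{(2)}.$$ If $\lambda\notin\{-1,0,1\}$, then with respect to $\mathcal{H}=\mathcal{N}(T)\oplus\mathcal{N}(T-I)\oplus\mathcal{N}(T-\lambda I)\oplus\mathcal{N}(T-(1+\lambda)I)\oplus\mathcal{H}_0$, $$W^*(\mathcal{T}_\lambda)=\mathbb{C}I\oplus\mathbb{C}I\oplus\mathbb{C}I\oplus\mathbb{C}I\oplus M_2(\{B\}'),$$ $$(W^*(\mathcal{T}_\lambda))'=\mathcal{B}(\mathcal{N}(T))\oplus\mathcal{B}(\mathcal{N}(T-I))\oplus\mathcal{B}(\mathcal{N}(T-\lambda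 I))\oplus\mathcal{B}(\mathcal{N}(T-(1+\lambda)I))\oplus W^*(B)^{(2)}.$$
   Context: $\mathcal{H}$ is an infinite-dimensional complex Hilbert space; "projection" means orthogonal projection; $\mathcal{P}(\mathcal{H})$ is the set of projections. For self-adjoint $A,C$, $A<C$ means $C-A$ is positive and injective. For self-adjoint $T$ and $\lambda\in\mathbb{R}$, $\mathcal{H}_0$ is the orthogonal complement of $\mathcal{N}(T)+\mathcal{N}(T-I)+\mathcal{N}(T-\lambda I)+\mathcal{N}(T-(1+\lambda)I)$; it reduces $T$ and $T_0=T|_{\mathcal{H}_0}$ is the generic part of $T$ with respect to $\lambda$. $\mathcal{T}_\lambda=\{(P,Q)\in\mathcal{P}(\mathcal{H})\times\mathcal{P}(\mathcal{H}): T=\lambda P+Q\}$ and $W^*(\mathcal{T}_\lambda)$ is the von Neumann algebra generated by all $P,Q$ with $(P,Q)\in\mathcal{T}_\lambda$. $\mathcal{F}'$ denotes commutant; $W^*(B)$ is the von Neumann algebra generated by $B$; $M_2(\mathcal{R})$ is the algebra of $2\times2$ operator matrices with entries in $\mathcal{R}$ on $\mathcal{K}\oplus\mathcal{K}$; $\mathcal{R}^{(2)}=\{R\oplus R:R\in\mathcal{R}\}$; each $\mathbb{C}I$ denotes the scalar multiples of the identity on the corresponding summand. *)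

theory Defs
  imports "HOL-Analysis.Analysis"
begin

class complex_vector = real_vector +
  fixes scaleC :: "complex \<Rightarrow> 'a \<Rightarrow> 'a"
  assumes scaleR_scaleC: "scaleR r x = scaleC (complex_of_real r) x"
    and scaleC_add_right: "scaleC a (x + y) = scaleC a x + scaleC a y"
    and scaleC_add_left: "scaleC (a + b) x = scaleC a x + scaleC b x"
    and scaleC_scaleC: "scaleC a (scaleC b x) = scaleC (a * b) x"
    and scaleC_one: "scaleC 1 x = x"

class chilbert = complex_vector + real_normed_vector + complete_space +
  fixes cinner :: "'a \<Rightarrow> 'a \<Rightarrow> complex"
  assumes cinner_add_left: "cinner (x + y) z = cinner x z + cinner y z"
    and cinner_scaleC_left: "cinner (scaleC c x) y = cnj c * cinner x y"
    and cinner_commute: "cinner x y = cnj (cinner y x)"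
    and cinner_ge_zero: "0 \<le> Re (cinner x x)"
    and cinner_eq_zero_iff: "cinner x x = 0 \<longleftrightarrow> x = 0"
    and norm_cinner: "norm x = sqrt (Re (cinner x x))"

definition cspan :: "'a::complex_vector set \<Rightarrow> 'a set" where
  "cspan S = {(\<Sum>x\<in>F. scaleC (c x) x) | F c. finite F \<and> F \<subseteq> S}"

definition infinite_dimensional :: "'a::complex_vector itself \<Rightarrow> bool" where
  "infinite_dimensional _ \<longleftrightarrow> \<not> (\<exists>F::'a set. finite F \<and> cspan F = UNIV)"

definition cbounded :: "('a::chilbert \<Rightarrow> 'a) \<Rightarrow> bool" where
  "cbounded A \<longleftrightarrow> (\<forall>x y. A (x + y) = A x + A y) \<and> (\<forall>c x. A (scaleC c x) = scaleC c (A x))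
     \<and> (\<exists>K. \<forall>x. norm (A x) \<le> K * norm x)"

definition cadj :: "('a::chilbert \<Rightarrow> 'a) \<Rightarrow> ('a \<Rightarrow> 'a)" where
  "cadj A = (THE B. cbounded B \<and> (\<forall>x y. cinner (A x) y = cinner x (B y)))"

definition cselfadj :: "('a::chilbert \<Rightarrow> 'a) \<Rightarrow> bool" where
  "cselfadj A \<longleftrightarrow> cbounded A \<and> (\<forall>x y. cinner (A x) y = cinner x (A y))"

definition cproj :: "('a::chilbert \<Rightarrow> 'a) \<Rightarrow> bool" where
  "cproj P \<longleftrightarrow> cselfadj P \<and> P \<circ> P = P"

definition cpositive :: "('a::chilbert \<Rightarrow> 'a) \<Rightarrow> bool" where
  "cpositive A \<longleftrightarrow> cbounded A \<and> (\<forall>x. cinner x (A x) \<in> \<real> \<and> 0 \<le> Re (cinner x (A x)))"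

definition op_less :: "('a::chilbert \<Rightarrow> 'a) \<Rightarrow> ('a \<Rightarrow> 'a) \<Rightarrow> bool" where
  "op_less A C \<longleftrightarrow> cpositive (\<lambda>x. C x - A x) \<and> inj (\<lambda>x. C x - A x)"

definition commutant :: "('a::chilbert \<Rightarrow> 'a) set \<Rightarrow> ('a \<Rightarrow> 'a) set" where
  "commutant F = {A. cbounded A \<and> (\<forall>X\<in>F. A \<circ> X = X \<circ> A)}"

definition von_neumann_algebra :: "('a::chilbert \<Rightarrow> 'a) set \<Rightarrow> bool" where
  "von_neumann_algebra M \<longleftrightarrow> M \<subseteq> {A. cbounded A} \<and> id \<in> M
     \<and> (\<forall>A\<in>M. \<forall>C\<in>M. (\<lambda>x. A x + C x) \<in> M \<and> A \<circ> C \<in> M)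
     \<and> (\<forall>c. \<forall>A\<in>M. (\<lambda>x. scaleC c (A x)) \<in> M)
     \<and> (\<forall>A\<in>M. cadj A \<in> M)
     \<and> commutant (commutant M) = M"

definition vN_gen :: "('a::chilbert \<Rightarrow> 'a) set \<Rightarrow> ('a \<Rightarrow> 'a) set" where
  "vN_gen S = \<Inter> {M. von_neumann_algebra M \<and> S \<subseteq> M}"

definition eigsp :: "('a::chilbert \<Rightarrow> 'a) \<Rightarrow> real \<Rightarrow> 'a set" where
  "eigsp T mu = {x. T x = scaleR mu x}"

definition orth_compl :: "'a::chilbert set \<Rightarrow> 'a set" where
  "orth_compl S = {x. \<forall>y\<in>S. cinner y x = 0}"

definition generic_space :: "('a::chilbert \<Rightarrow> 'a) \<Rightarrow> real \<Rightarrow> 'a set" where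
  "generic_space T lam = orth_compl {a + b + c + d | a b c d.
      a \<in> eigsp T 0 \<and> b \<in> eigsp T 1 \<and> c \<in> eigsp T lam \<and> d \<in> eigsp T (1 + lam)}"

definition T_pairs :: "('a::chilbert \<Rightarrow> 'a) \<Rightarrow> real \<Rightarrow> (('a \<Rightarrow> 'a) \<times> ('a \<Rightarrow> 'a)) set" where
  "T_pairs T lam = {(P, Q). cproj P \<and> cproj Q \<and> T = (\<lambda>x. scaleR lam (P x) + Q x)}"

definition WT :: "('a::chilbert \<Rightarrow> 'a) \<Rightarrow> real \<Rightarrow> ('a \<Rightarrow> 'a) set" where
  "WT T lam = vN_gen (fst ` T_pairs T lam \<union> snd ` T_pairs T lam)"

text \<open>U is a unitary from K (+) K onto the subspace S of H (identification H_0 = K (+) K).\<close>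
definition pair_unitary :: "('k::chilbert \<times> 'k \<Rightarrow> 'a::chilbert) \<Rightarrow> 'a set \<Rightarrow> bool" where
  "pair_unitary U S \<longleftrightarrow>
     (\<forall>x y x' y'. U (x + x', y + y') = U (x, y) + U (x', y'))
   \<and> (\<forall>c x y. U (scaleC c x, scaleC c y) = scaleC c (U (x, y)))
   \<and> (\<forall>x y x' y'. cinner (U (x, y)) (U (x', y')) = cinner x x' + cinner y y')
   \<and> range U = S"

text \<open>Summand descriptions: A restricted to the reducing subspace S is a scalar (C I),
  respectively an arbitrary operator on S (B(S)).\<close>
definition scalar_on :: "('a::chilbert \<Rightarrow> 'a) \<Rightarrow> 'a set \<Rightarrow> bool" where
  "scalar_on A S \<longleftrightarrow> (\<exists>c. \<forall>x\<in>S. A x = scaleC c x)"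

definition invariant_on :: "('a::chilbert \<Rightarrow> 'a) \<Rightarrow> 'a set \<Rightarrow> bool" where
  "invariant_on A S \<longleftrightarrow> (\<forall>x\<in>S. A x \<in> S)"

definition M2_on :: "('a::chilbert \<Rightarrow> 'a) \<Rightarrow> ('k::chilbert \<times> 'k \<Rightarrow> 'a) \<Rightarrow> ('k \<Rightarrow> 'k) set \<Rightarrow> bool" where
  "M2_on A U R \<longleftrightarrow> (\<exists>A11 A12 A21 A22. A11 \<in> R \<and> A12 \<in> R \<and> A21 \<in> R \<and> A22 \<in> R \<and>
     (\<forall>x y. A (U (x, y)) = U (A11 x + A12 y, A21 x + A22 y)))"

definition diag2_on :: "('a::chilbert \<Rightarrow> 'a) \<Rightarrow> ('k::chilbert \<times> 'k \<Rightarrow> 'a) \<Rightarrow> ('k \<Rightarrow> 'k) set \<Rightarrow> bool" where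
  "diag2_on A U R \<longleftrightarrow> (\<exists>X\<in>R. \<forall>x y. A (U (x, y)) = U (X x, X y))"

end

theory Submission
  imports Defs
begin

text \<open>Put \<open>S = T - (1 + \<lambda>)/2\<close> and \<open>V = 2Q - I\<close>. That \<open>(T - Q)/\<lambda>\<close> is idempotent means
  \<open>S V + V S = 2 S\<^sup>2 + (1 - \<lambda>\<^sup>2)/2\<close>. On \<open>\<K> \<oplus> \<K>\<close>, where \<open>S = B \<oplus> (-B)\<close>, this forces the off-diagonal
  entries of \<open>V\<close> to commute with \<open>B\<close> and the diagonal ones to commute with \<open>B\<^sup>2\<close>, hence with its
  positive root \<open>B\<close>. So \<open>Y \<oplus> Y\<close> with \<open>Y \<in> {B}''\<close> commutes with all pairs. Conversely, with
  \<open>a = B + (1 - \<lambda>\<^sup>2)/4 B\<^sup>-\<^sup>1\<close> and \<open>c = (1 - a\<^sup>2)\<^sup>1\<^sup>/\<^sup>2\<close>, which is injective, every unitary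
  \<open>u \<in> {B}'\<close> gives a pair with \<open>V\<close> equal to the matrix with rows \<open>(a, c u)\<close> and \<open>(c u\<^sup>*, -a)\<close>.
  An operator commuting with \<open>T\<close> is diagonal on \<open>\<K> \<oplus> \<K>\<close>; commuting with all these \<open>V\<close> makes its
  diagonal entries equal and in \<open>{B}''\<close>, since unitaries span \<open>{B}'\<close>. On the eigenspaces \<open>P\<close> and
  \<open>Q\<close> are scalars, except for the common eigenspace of \<open>1\<close> and \<open>\<lambda>\<close> when \<open>\<lambda> = 1\<close>. The algebra is
  the commutant of the commutant found in this way.\<close>

section \<open>Complex Hilbert spaces\<close>

text \<open>The relation between \<open>S\<close> and \<open>V\<close> expresses that
  \<open>\<lambda> (2 P - I) = 2 S - V\<close>: the square of the right side must be
  \<open>\<lambda>\<^sup>2\<close>. Its upper diagonal entry involves only \<open>B\<close> and the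
  corner \<open>V11\<close>; once \<open>V11\<close> commutes with \<open>B\<close>, injectivity of
  \<open>B\<close> makes \<open>a\<close> the only solution. Then \<open>V\<^sup>2 = I\<close>
  leaves \<open>1 - a\<^sup>2\<close> for the product of the off-diagonal corner with its adjoint,
  so the remaining freedom is a phase \<open>u\<close> next to the root \<open>c\<close>. This is
  the origin of the family of pairs. The phase carries the information: \<open>u = I\<close> alone
  shows that the diagonal entries of a commuting operator agree, and varying \<open>u\<close> moves
  them from \<open>{B}'\<close> into \<open>{B}''\<close>. To compare entries one has to cancel
  \<open>c\<close>, and for that the strict bounds on \<open>B\<close> must give an injective
  \<open>1 - a\<^sup>2\<close>, not merely a positive one. Functions of \<open>B\<close> are built
  only from a bounded inverse and positive square roots, always together with the fact that they
  commute with whatever commutes with the operator they come from. This takes the place of a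
  functional calculus.\<close>

lemma cinner_add_right: "cinner x (y + z) = cinner x y + cinner x (z::'a::chilbert)"
  by (metis cinner_add_left cinner_commute complex_cnj_add)

lemma cinner_scaleC_right: "cinner x (scaleC c y) = c * cinner x (y::'a::chilbert)"
  by (metis cinner_commute cinner_scaleC_left complex_cnj_cnj complex_cnj_mult)

lemma cinner_scaleR_left: "cinner (scaleR r x) y = of_real r * cinner x (y::'a::chilbert)"
  by (simp add: scaleR_scaleC cinner_scaleC_left)

lemma cinner_scaleR_right: "cinner x (scaleR r y) = of_real r * cinner x (y::'a::chilbert)"
  by (simp add: scaleR_scaleC cinner_scaleC_right)

lemma cinner_minus_left: "cinner (- x) y = - cinner x (y::'a::chilbert)"
  using cinner_scaleR_left[of "-1" x y] by simp

lemma cinner_minus_right: "cinner x (- y) = - cinner x (y::'a::chilbert)"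
  using cinner_scaleR_right[of x "-1" y] by simp

lemma cinner_zero_left [simp]: "cinner 0 (y::'a::chilbert) = 0"
  using cinner_scaleR_left[of 0 y y] by simp

lemma cinner_zero_right [simp]: "cinner (y::'a::chilbert) 0 = 0"
  using cinner_scaleR_right[of y 0 y] by simp

lemma cinner_diff_left: "cinner (x - y) z = cinner x z - cinner y (z::'a::chilbert)"
  using cinner_add_left[of x "- y" z] by (simp add: cinner_minus_left)

lemma cinner_diff_right: "cinner x (y - z) = cinner x y - cinner x (z::'a::chilbert)"
  using cinner_add_right[of x y "- z"] by (simp add: cinner_minus_right)

lemmas cinner_lin = cinner_add_left cinner_add_right cinner_diff_left cinner_diff_right
  cinner_scaleR_left cinner_scaleR_right cinner_minus_left cinner_minus_right
  cinner_scaleC_left cinner_scaleC_right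

lemma cinner_self: "cinner x x = of_real ((norm (x::'a::chilbert))\<^sup>2)"
proof -
  have "Im (cinner x x) = 0"
    by (metis cinner_commute complex_cnj_cancel_iff complex_cnj_zero_iff
        cnj.sel(2) equation_minus_iff neg_equal_zero)
  moreover have "Re (cinner x x) = (norm x)\<^sup>2"
    by (simp add: norm_cinner cinner_ge_zero)
  ultimately show ?thesis by (simp add: complex_eq_iff)
qed

lemma cmod_cinner_self: "cmod (cinner x x) = (norm (x::'a::chilbert))\<^sup>2"
  by (simp add: cinner_self norm_power)

lemma cinner_sym_zero: "cinner x y = 0 \<longleftrightarrow> cinner y (x::'a::chilbert) = 0"
  by (metis cinner_commute complex_cnj_zero)

lemma Re_cinner_commute: "Re (cinner x y) = Re (cinner y (x::'a::chilbert))"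
  by (metis cinner_commute cnj.simps(1))

lemma cinner_extR: "(\<And>z. cinner z x = cinner z y) \<Longrightarrow> x = (y::'a::chilbert)"
  by (metis cinner_diff_right cinner_eq_zero_iff eq_iff_diff_eq_0)

lemma scaleC_zero_left [simp]: "scaleC 0 (x::'a::complex_vector) = 0"
  using scaleR_scaleC[of 0 x] by simp

lemma scaleC_zero_right [simp]: "scaleC c (0::'a::complex_vector) = 0"
  by (metis add_cancel_left_left scaleC_add_right)

lemma scaleC_minus_right: "scaleC c (- x) = - scaleC c (x::'a::complex_vector)"
  by (metis add.right_inverse add_eq_0_iff scaleC_add_right scaleC_zero_right)

lemma scaleC_minus_left: "scaleC (- c) x = - scaleC c (x::'a::complex_vector)"
  by (metis add.right_inverse add_eq_0_iff scaleC_add_left scaleC_zero_left)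

lemma scaleC_diff_right: "scaleC c (x - y) = scaleC c x - scaleC c (y::'a::complex_vector)"
  using scaleC_add_right[of c x "- y"] by (simp add: scaleC_minus_right)

lemma scaleC_diff_left: "scaleC (c - d) x = scaleC c x - scaleC d (x::'a::complex_vector)"
  using scaleC_add_left[of c "- d" x] by (simp add: scaleC_minus_left)

lemma scaleC_scaleR: "scaleC c (scaleR r x) = scaleR r (scaleC c (x::'a::complex_vector))"
  by (simp add: scaleR_scaleC scaleC_scaleC mult.commute)

lemma norm_sq_diff: "(norm (x - y))\<^sup>2 = (norm x)\<^sup>2 - 2 * Re (cinner x y) + (norm (y::'a::chilbert))\<^sup>2"
proof -
  have "of_real ((norm (x - y))\<^sup>2) = cinner (x - y) (x - y)" by (simp only: cinner_self)
  also have "\<dots> = cinner x x - cinner x y - cinner y x + cinner y y"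
    by (simp add: cinner_lin)
  finally have "Re (of_real ((norm (x - y))\<^sup>2)) = Re (cinner x x - cinner x y - cinner y x + cinner y y)"
    by simp
  then show ?thesis using Re_cinner_commute[of x y] by (simp add: cinner_self)
qed

lemma norm_scaleC: "norm (scaleC c x) = cmod c * norm (x::'a::chilbert)"
proof -
  have "cinner (scaleC c x) (scaleC c x) = of_real ((cmod c * norm x)\<^sup>2)"
    by (simp only: cinner_scaleC_left cinner_scaleC_right cinner_self[of x] power_mult_distrib of_real_mult
        complex_norm_square mult_ac)
  then have "(norm (scaleC c x))\<^sup>2 = (cmod c * norm x)\<^sup>2"
    by (simp only: cinner_self of_real_eq_iff)
  then show ?thesis by (simp add: power2_eq_iff_nonneg)
qed

lemma cauchy_schwarz: "cmod (cinner x y) \<le> norm x * norm (y::'a::chilbert)"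
proof (cases "y = 0")
  case False
  define c where "c = cinner y x"
  define s where "s = 1 / (norm y)\<^sup>2"
  have s: "s * (norm y)\<^sup>2 = 1" using False by (simp add: s_def)
  \<comment> \<open>The subtracted vector is the projection of \<open>x\<close> onto the line of
    \<open>y\<close>.\<close>
  have "0 \<le> (norm (x - scaleR s (scaleC c y)))\<^sup>2" by simp
  also have "\<dots> = (norm x)\<^sup>2 - 2 * Re (cinner x (scaleR s (scaleC c y))) + (norm (scaleR s (scaleC c y)))\<^sup>2"
    by (rule norm_sq_diff)
  also have "cinner x (scaleR s (scaleC c y)) = of_real (s * (cmod c)\<^sup>2)"
    using cinner_commute[of x y]
    by (simp add: cinner_lin c_def complex_norm_square[symmetric] del: of_real_power)
  also have "(norm (scaleR s (scaleC c y)))\<^sup>2 = s * (cmod c)\<^sup>2 * (s * (norm y)\<^sup>2)"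
    by (simp add: norm_scaleC power_mult_distrib power2_eq_square)
  also have "(norm x)\<^sup>2 - 2 * Re (of_real (s * (cmod c)\<^sup>2)) + s * (cmod c)\<^sup>2 * (s * (norm y)\<^sup>2)
     = (norm x)\<^sup>2 - s * (cmod c)\<^sup>2"
    unfolding s by simp
  finally have "s * (cmod c)\<^sup>2 \<le> (norm x)\<^sup>2" by simp
  then have "(s * (norm y)\<^sup>2) * (cmod c)\<^sup>2 \<le> (norm x)\<^sup>2 * (norm y)\<^sup>2"
    by (metis mult.assoc mult.commute mult_left_mono zero_le_power2)
  then have "(cmod c)\<^sup>2 \<le> (norm x * norm y)\<^sup>2" by (simp add: s power_mult_distrib)
  then have "cmod c \<le> norm x * norm y" by (rule power2_le_imp_le) simp
  then show ?thesis using cinner_commute[of x y] by (simp add: c_def)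
qed simp

lemma bounded_bilinear_cinner: "bounded_bilinear (cinner :: 'a::chilbert \<Rightarrow> 'a \<Rightarrow> complex)"
proof
  show "\<exists>K. \<forall>a b. norm (cinner (a::'a) b) \<le> norm a * norm b * K"
    using cauchy_schwarz by (intro exI[of _ 1]) auto
qed (auto simp: cinner_lin scaleR_conv_of_real)

lemmas tendsto_cinner = bounded_bilinear.tendsto[OF bounded_bilinear_cinner]

section \<open>Bounded complex-linear operators\<close>

lemma cboundedI:
  assumes "\<And>x y. A (x + y) = A x + A y" "\<And>c x. A (scaleC c x) = scaleC c (A x)"
    "\<And>x. norm (A x) \<le> K * norm x"
  shows "cbounded A"
  using assms unfolding cbounded_def by blast

lemma cb_add: "cbounded A \<Longrightarrow> A (x + y) = A x + A y"
  and cb_scaleC: "cbounded A \<Longrightarrow> A (scaleC c x) = scaleC c (A x)"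
  by (auto simp: cbounded_def)

lemma cb_scaleR: "cbounded A \<Longrightarrow> A (scaleR r x) = scaleR r (A x)"
  by (simp add: scaleR_scaleC cb_scaleC)

lemma cb_zero: "cbounded A \<Longrightarrow> A 0 = 0"
  using cb_scaleR[of A 0 0] by simp

lemma cb_minus: "cbounded A \<Longrightarrow> A (- x) = - A x"
  using cb_scaleR[of A "-1" x] by simp

lemma cb_diff: "cbounded A \<Longrightarrow> A (x - y) = A x - A y"
  using cb_add[of A x "- y"] by (simp add: cb_minus)

lemmas cb_lin = cb_add cb_diff cb_minus cb_scaleR cb_scaleC cb_zero

lemma cb_pos_bound:
  assumes "cbounded A"
  obtains K where "K > 0" "\<And>x. norm (A x) \<le> K * norm x"
proof -
  obtain K where K: "\<And>x. norm (A x) \<le> K * norm x"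
    using assms unfolding cbounded_def by blast
  have "norm (A x) \<le> (\<bar>K\<bar> + 1) * norm x" for x
    using order_trans[OF K[of x] mult_right_mono[of K "\<bar>K\<bar> + 1" "norm x"]] by simp
  then show ?thesis using that[of "\<bar>K\<bar> + 1"] by auto
qed

lemma cb_bounded_linear: "cbounded A \<Longrightarrow> bounded_linear A"
  by (metis (no_types) bounded_linear_intro cb_add cb_pos_bound cb_scaleR mult.commute)

lemmas cb_tendsto = bounded_linear.tendsto[OF cb_bounded_linear]

lemma cbounded_id: "cbounded (\<lambda>x. x)"
  by (rule cboundedI[of _ 1]) auto

lemma cbounded_zero: "cbounded (\<lambda>x. 0)"
  by (rule cboundedI[of _ 0]) auto


lemma cbounded_add:
  assumes "cbounded A" "cbounded C" shows "cbounded (\<lambda>x. A x + C x)"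
proof -
  obtain K where K: "\<And>x. norm (A x) \<le> K * norm x" by (metis cb_pos_bound[OF assms(1)])
  obtain L where L: "\<And>x. norm (C x) \<le> L * norm x" by (metis cb_pos_bound[OF assms(2)])
  have "norm (A x + C x) \<le> (K + L) * norm x" for x
    using norm_triangle_mono[OF K[of x] L[of x]] by (simp add: algebra_simps)
  then show ?thesis using assms
    by (intro cboundedI[of _ "K + L"]) (auto simp: cb_lin scaleC_add_right algebra_simps)
qed

lemma cbounded_scaleC:
  assumes "cbounded A" shows "cbounded (\<lambda>x. scaleC c (A x))"
proof -
  obtain K where K: "\<And>x. norm (A x) \<le> K * norm x" by (metis cb_pos_bound[OF assms(1)])
  have "norm (scaleC c (A x)) \<le> (cmod c * K) * norm x" for x
    using mult_left_mono[OF K[of x], of "cmod c"] by (simp add: norm_scaleC algebra_simps)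
  then show ?thesis using assms
    by (intro cboundedI[of _ "cmod c * K"]) (auto simp: cb_lin scaleC_add_right scaleC_scaleC mult.commute)
qed

lemma cbounded_scaleR: "cbounded A \<Longrightarrow> cbounded (\<lambda>x. scaleR r (A x))"
  by (simp add: scaleR_scaleC cbounded_scaleC)

lemma cbounded_minus: "cbounded A \<Longrightarrow> cbounded (\<lambda>x. - A x)"
  using cbounded_scaleR[of A "-1"] by simp

lemma cbounded_diff: "cbounded A \<Longrightarrow> cbounded C \<Longrightarrow> cbounded (\<lambda>x. A x - C x)"
  using cbounded_add[of A "\<lambda>x. - C x"] by (simp add: cbounded_minus)

lemma cbounded_comp:
  assumes "cbounded A" "cbounded C" shows "cbounded (\<lambda>x. A (C x))"
proof -
  obtain K where K: "\<And>x. norm (A x) \<le> K * norm x" "K > 0" by (metis cb_pos_bound[OF assms(1)])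
  obtain L where L: "\<And>x. norm (C x) \<le> L * norm x" by (metis cb_pos_bound[OF assms(2)])
  have "norm (A (C x)) \<le> (K * L) * norm x" for x
    using order_trans[OF K(1)[of "C x"] mult_left_mono[OF L[of x], of K]] K(2) by (simp add: algebra_simps)
  then show ?thesis using assms
    by (intro cboundedI[of _ "K * L"]) (auto simp: cb_lin)
qed

lemmas cbounded_intros = cbounded_id cbounded_zero cbounded_add cbounded_scaleC cbounded_scaleR
  cbounded_minus cbounded_diff

lemmas cbounded_ops = cbounded_id cbounded_zero cbounded_add cbounded_scaleC cbounded_scaleR
  cbounded_minus cbounded_diff cbounded_comp

section \<open>Orthogonal projections, Riesz representation and adjoints\<close>

definition csubsp :: "'a::chilbert set \<Rightarrow> bool" where
  "csubsp S \<longleftrightarrow> closed S \<and> 0 \<in> S \<and> (\<forall>x\<in>S. \<forall>y\<in>S. x + y \<in> S) \<and> (\<forall>c. \<forall>x\<in>S. scaleC c x \<in> S)"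

lemma csubsp_scaleR: "csubsp S \<Longrightarrow> x \<in> S \<Longrightarrow> scaleR r x \<in> S"
  by (simp add: csubsp_def scaleR_scaleC)

lemma csubsp_diff: "csubsp S \<Longrightarrow> x \<in> S \<Longrightarrow> y \<in> S \<Longrightarrow> x - y \<in> S"
  using csubsp_scaleR[of S y "-1"] unfolding csubsp_def
  by (metis scaleR_minus1_left uminus_add_conv_diff add.commute)

lemma parallelogram: "(norm (x - y))\<^sup>2 = 2 * (norm x)\<^sup>2 + 2 * (norm y)\<^sup>2 - (norm (x + (y::'a::chilbert)))\<^sup>2"
  using norm_sq_diff[of x y] norm_sq_diff[of x "- y"] by (simp add: cinner_lin)

text \<open>Midpoints of elements of \<open>S\<close> stay in \<open>S\<close>, so by the
  parallelogram law two almost minimizing elements are close to each other. A minimizing sequence is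
  therefore Cauchy.\<close>

lemma closest_point:
  fixes S :: "'a::chilbert set"
  assumes S: "csubsp S"
  shows "\<exists>s\<in>S. \<forall>y\<in>S. norm (x - s) \<le> norm (x - y)"
proof -
  define d where "d = (INF s\<in>S. (norm (x - s))\<^sup>2)"
  have bdd: "bdd_below ((\<lambda>s. (norm (x - s))\<^sup>2) ` S)" by (rule bdd_belowI2[of _ 0]) simp
  have ne: "S \<noteq> {}" using S by (auto simp: csubsp_def)
  have dle: "d \<le> (norm (x - s))\<^sup>2" if "s \<in> S" for s
    unfolding d_def by (rule cINF_lower[OF bdd that])
  have "\<exists>s\<in>S. (norm (x - s))\<^sup>2 < d + 1 / real (Suc n)" for n
    using cINF_less_iff[OF ne bdd, of "d + 1 / real (Suc n)"] by (simp add: d_def)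
  then obtain s where sS: "\<And>n. s n \<in> S" and s: "\<And>n. (norm (x - s n))\<^sup>2 < d + 1 / real (Suc n)"
    by metis
  have dist_sq: "(norm (s m - s n))\<^sup>2 \<le> 2 / real (Suc m) + 2 / real (Suc n)" for m n
  proof -
    have "scaleR (1/2) (s m + s n) \<in> S"
      using S sS by (intro csubsp_scaleR) (auto simp: csubsp_def)
    from dle[OF this] have "4 * d \<le> 4 * (norm (x - scaleR (1/2) (s m + s n)))\<^sup>2" by simp
    also have "\<dots> = (norm (scaleR 2 (x - scaleR (1/2) (s m + s n))))\<^sup>2"
      by (simp add: power_mult_distrib)
    also have "scaleR 2 (x - scaleR (1/2) (s m + s n)) = (x - s n) + (x - s m)"
      by (simp add: algebra_simps scaleR_2)
    finally have "4 * d \<le> (norm ((x - s n) + (x - s m)))\<^sup>2" .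
    then show ?thesis
      using parallelogram[of "x - s n" "x - s m"] s[of m] s[of n] by simp
  qed
  have "Cauchy s"
  proof (rule CauchyI)
    fix e :: real assume e: "e > 0"
    obtain M where M: "inverse (real (Suc M)) < e\<^sup>2 / 4"
      using reals_Archimedean[of "e\<^sup>2 / 4"] e by auto
    show "\<exists>M. \<forall>m\<ge>M. \<forall>n\<ge>M. norm (s m - s n) < e"
    proof (intro exI allI impI)
      fix m n assume mn: "m \<ge> M" "n \<ge> M"
      have "1 / real (Suc m) \<le> inverse (real (Suc M))" "1 / real (Suc n) \<le> inverse (real (Suc M))"
        using mn by (auto simp: inverse_eq_divide intro!: divide_left_mono)
      then have "(norm (s m - s n))\<^sup>2 < e\<^sup>2" using dist_sq[of m n] M by simp
      then show "norm (s m - s n) < e" using e by (simp add: power_less_imp_less_base)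
    qed
  qed
  then obtain l where l: "s \<longlonglongrightarrow> l" by (auto simp: Cauchy_convergent_iff convergent_def)
  have lS: "l \<in> S" using S sS l closed_sequentially[of S s l] by (auto simp: csubsp_def)
  have "(\<lambda>n. (norm (x - s n))\<^sup>2) \<longlonglongrightarrow> (norm (x - l))\<^sup>2" by (intro tendsto_intros l)
  moreover have "(\<lambda>n. d + 1 / real (Suc n)) \<longlonglongrightarrow> d + 0"
    by (intro tendsto_intros LIMSEQ_Suc[OF lim_1_over_n])
  ultimately have "(norm (x - l))\<^sup>2 \<le> d"
    using LIMSEQ_le s less_imp_le by (metis (no_types, lifting) add.right_neutral)
  then show ?thesis using lS dle
    by (meson norm_ge_zero order_trans power2_le_imp_le)
qed

lemma projection_theorem:
  fixes S :: "'a::chilbert set"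
  assumes S: "csubsp S"
  shows "\<exists>s\<in>S. \<forall>y\<in>S. cinner y (x - s) = 0"
proof -
  obtain s where sS: "s \<in> S" and s: "\<And>y. y \<in> S \<Longrightarrow> norm (x - s) \<le> norm (x - y)"
    using closest_point[OF S, of x] by blast
  have "cinner y (x - s) = 0" if y: "y \<in> S" for y
  proof -
    define c where "c = cinner y (x - s)"
    \<comment> \<open>The step \<open>e\<close> is so short that the quadratic term of the expansion
      is dominated by the linear one; minimality of \<open>s\<close> then leaves no room for
      \<open>c \<noteq> 0\<close>.\<close>
    define e where "e = 1 / ((norm y)\<^sup>2 + 1)"
    have "0 < (norm y)\<^sup>2 + 1" by (rule add_nonneg_pos) auto
    then have e: "e > 0" "e * (norm y)\<^sup>2 < 1" by (simp_all add: e_def)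
    have "s + scaleR e (scaleC c y) \<in> S"
      using S sS y csubsp_scaleR[OF S] by (auto simp: csubsp_def)
    from s[OF this] have "(norm (x - s))\<^sup>2 \<le> (norm ((x - s) - scaleR e (scaleC c y)))\<^sup>2"
      by (intro power_mono) (auto simp: algebra_simps)
    also have "\<dots> = (norm (x - s))\<^sup>2 - 2 * Re (cinner (x - s) (scaleR e (scaleC c y))) + (norm (scaleR e (scaleC c y)))\<^sup>2"
      by (rule norm_sq_diff)
    also have "cinner (x - s) (scaleR e (scaleC c y)) = of_real (e * (cmod c)\<^sup>2)"
    proof -
      have "cinner (x - s) y = cnj c" unfolding c_def by (rule cinner_commute)
      then show ?thesis
        by (simp only: cinner_scaleR_right cinner_scaleC_right of_real_mult complex_norm_square)
    qed
    finally have "2 * (cmod c)\<^sup>2 * e \<le> e * (cmod c)\<^sup>2 * (e * (norm y)\<^sup>2)"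
      by (simp add: norm_scaleC power_mult_distrib power2_eq_square algebra_simps)
    also have "\<dots> \<le> e * (cmod c)\<^sup>2 * 1" using e by (intro mult_left_mono) auto
    finally have "(cmod c)\<^sup>2 \<le> 0" using e by (simp add: algebra_simps)
    then show ?thesis by (simp add: c_def)
  qed
  then show ?thesis using sS by blast
qed

definition projon :: "'a::chilbert set \<Rightarrow> 'a \<Rightarrow> 'a" where
  "projon S x = (SOME s. s \<in> S \<and> (\<forall>y\<in>S. cinner y (x - s) = 0))"

lemma projon:
  assumes "csubsp S"
  shows projon_in: "projon S x \<in> S" and projon_orth: "y \<in> S \<Longrightarrow> cinner y (x - projon S x) = 0"
  using someI_ex[of "\<lambda>s. s \<in> S \<and> (\<forall>y\<in>S. cinner y (x - s) = 0)"] projection_theorem[OF assms, of x]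
  unfolding projon_def by blast+

lemma projon_unique:
  assumes S: "csubsp S" and "s \<in> S" "\<And>y. y \<in> S \<Longrightarrow> cinner y (x - s) = 0"
  shows "projon S x = s"
proof -
  have d: "projon S x - s \<in> S" using assms projon_in csubsp_diff by blast
  have "cinner (projon S x - s) ((x - s) - (x - projon S x)) = 0"
    using assms(3)[OF d] projon_orth[OF S d] by (simp add: cinner_diff_right)
  then show ?thesis by (simp add: cinner_eq_zero_iff)
qed

lemma projon_fix: "csubsp S \<Longrightarrow> x \<in> S \<Longrightarrow> projon S x = x"
  by (rule projon_unique) auto

lemma projon_cbounded:
  fixes S :: "'a::chilbert set"
  assumes S: "csubsp S" shows "cbounded (projon S)"
proof (rule cboundedI[of _ 1])
  note p = projon_in[OF S] projon_orth[OF S]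
  fix x y :: 'a and c :: complex
  show "projon S (x + y) = projon S x + projon S y"
  proof (rule projon_unique[OF S])
    show "projon S x + projon S y \<in> S" using S p by (auto simp: csubsp_def)
    fix z assume "z \<in> S"
    then have "cinner z ((x - projon S x) + (y - projon S y)) = 0" by (simp only: cinner_add_right p) simp
    then show "cinner z (x + y - (projon S x + projon S y)) = 0" by (simp add: algebra_simps)
  qed
  show "projon S (scaleC c x) = scaleC c (projon S x)"
  proof (rule projon_unique[OF S])
    show "scaleC c (projon S x) \<in> S" using S p by (auto simp: csubsp_def)
    fix z assume "z \<in> S"
    then have "cinner z (scaleC c (x - projon S x)) = 0" by (simp only: cinner_scaleC_right p) simp
    then show "cinner z (scaleC c x - scaleC c (projon S x)) = 0" by (simp add: scaleC_diff_right)
  qed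
  have "cinner (projon S x) x = cinner (projon S x) (projon S x)"
    using p(2)[OF p(1), of x x] by (simp add: cinner_diff_right)
  then have "(norm (projon S x))\<^sup>2 = cmod (cinner (projon S x) x)" by (simp add: cmod_cinner_self)
  also have "\<dots> \<le> norm (projon S x) * norm x" by (rule cauchy_schwarz)
  finally show "norm (projon S x) \<le> 1 * norm x"
    by (cases "projon S x = 0") (auto simp: power2_eq_square)
qed

lemma projon_selfadj:
  fixes S :: "'a::chilbert set"
  assumes S: "csubsp S"
  shows "cinner (projon S x) y = cinner x (projon S y)"
proof -
  have a: "cinner (projon S x) y = cinner (projon S x) (projon S y)" for x y
    using projon_orth[OF S projon_in[OF S], of x y] by (simp add: cinner_diff_right)
  show ?thesis using a[of x y] a[of y x] by (metis cinner_commute)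
qed

lemma cproj_projon:
  assumes S: "csubsp S" shows "cproj (projon S)"
  unfolding cproj_def cselfadj_def
  using projon_cbounded[OF S] projon_selfadj[OF S] projon_fix[OF S] projon_in[OF S]
  by (auto simp: fun_eq_iff)

lemma projon_zero:
  assumes S: "csubsp S" and "\<And>y. y \<in> S \<Longrightarrow> cinner y x = 0" shows "projon S x = 0"
  using assms by (intro projon_unique) (auto simp: csubsp_def)

lemma riesz:
  fixes f :: "'a::chilbert \<Rightarrow> complex"
  assumes add: "\<And>x y. f (x + y) = f x + f y" and sc: "\<And>c x. f (scaleC c x) = c * f x"
    and K: "\<And>x. cmod (f x) \<le> K * norm x"
  shows "\<exists>z. \<forall>x. f x = cinner z x"
proof (cases "\<forall>x. f x = 0")
  case True then show ?thesis by (intro exI[of _ 0]) auto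
next
  case False
  then obtain w where w: "f w \<noteq> 0" by blast
  have bl: "bounded_linear f"
    by (rule bounded_linear_intro[of _ K])
      (use add sc K in \<open>auto simp: scaleR_scaleC scaleR_conv_of_real mult.commute\<close>)
  have f0: "f 0 = 0" by (rule linear_0[OF bounded_linear.linear[OF bl]])
  have fd: "f (x - y) = f x - f y" for x y by (rule linear_diff[OF bounded_linear.linear[OF bl]])
  define S where "S = {x. f x = 0}"
  have S: "csubsp S" unfolding csubsp_def S_def
    using add sc f0
    by (auto intro!: closed_Collect_eq continuous_intros bounded_linear.continuous_on[OF bl])
  \<comment> \<open>The component of \<open>w\<close> orthogonal to the kernel spans the complement
    of the kernel; a multiple of it represents \<open>f\<close>.\<close>
  define n where "n = w - projon S w"
  have nS: "\<And>y. y \<in> S \<Longrightarrow> cinner n y = 0"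
    unfolding n_def using projon_orth[OF S] cinner_sym_zero by blast
  have fn: "f n \<noteq> 0" using w projon_in[OF S, of w] by (simp add: n_def fd S_def)
  then have n0: "n \<noteq> 0" using f0 by auto
  have "f x = cinner (scaleC (cnj (f n / cinner n n)) n) x" for x
  proof -
    \<comment> \<open>This combination is the one that \<open>f\<close> annihilates, hence it is
      orthogonal to \<open>n\<close>.\<close>
    have "scaleC (f n) x - scaleC (f x) n \<in> S" by (simp add: S_def fd sc)
    from nS[OF this] have "f n * cinner n x = f x * cinner n n" by (simp add: cinner_lin)
    then show ?thesis using n0 by (simp add: cinner_lin cinner_eq_zero_iff field_simps)
  qed
  then show ?thesis by blast
qed

lemma adjoint_exists:
  fixes A :: "'a::chilbert \<Rightarrow> 'a"
  assumes A: "cbounded A"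
  shows "\<exists>B. cbounded B \<and> (\<forall>x y. cinner (A x) y = cinner x (B y))"
proof -
  obtain K where K: "K > 0" "\<And>x. norm (A x) \<le> K * norm x" by (rule cb_pos_bound[OF A]) blast
  have "\<exists>z. \<forall>x. cinner y (A x) = cinner z x" for y
  proof (rule riesz[of _ "norm y * K"])
    fix x show "cmod (cinner y (A x)) \<le> norm y * K * norm x"
      using order_trans[OF cauchy_schwarz mult_left_mono[OF K(2)], of y] by (simp add: mult.assoc)
  qed (auto simp: cb_lin[OF A] cinner_lin)
  then obtain B where B: "\<And>x y. cinner y (A x) = cinner (B y) x" by metis
  have B': "cinner (A x) y = cinner x (B y)" for x y
    by (metis B cinner_commute)
  have "cbounded B"
  proof (rule cboundedI[of _ K])
    fix x y c
    show "B (x + y) = B x + B y" by (rule cinner_extR) (simp add: cinner_lin B'[symmetric])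
    show "B (scaleC c x) = scaleC c (B x)" by (rule cinner_extR) (simp add: cinner_lin B'[symmetric])
    have "(norm (B y))\<^sup>2 = cmod (cinner (B y) (B y))" by (simp add: cmod_cinner_self)
    also have "\<dots> = cmod (cinner (A (B y)) y)" by (simp add: B')
    also have "\<dots> \<le> norm (A (B y)) * norm y" by (rule cauchy_schwarz)
    also have "\<dots> \<le> K * norm (B y) * norm y" by (intro mult_right_mono K) simp
    finally show "norm (B y) \<le> K * norm y"
      by (cases "B y = 0") (use K in \<open>auto simp: power2_eq_square\<close>)
  qed
  then show ?thesis using B' by blast
qed

text \<open>The property describing \<open>cadj A\<close> has exactly one solution:
  \<open>adjoint_exists\<close> gives existence and \<open>cinner_extR\<close> uniqueness. So the
  definite description denotes it.\<close>

lemma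
  assumes A: "cbounded A"
  shows cbounded_cadj: "cbounded (cadj A)" and cadj: "cinner (A x) y = cinner x (cadj A y)"
    and cadj': "cinner (cadj A x) y = cinner x (A y)"
proof -
  have "\<exists>!B. cbounded B \<and> (\<forall>x y. cinner (A x) y = cinner x (B y))"
  proof (rule ex_ex1I)
    show "\<exists>B. cbounded B \<and> (\<forall>x y. cinner (A x) y = cinner x (B y))" by (rule adjoint_exists[OF A])
    fix B C assume "cbounded B \<and> (\<forall>x y. cinner (A x) y = cinner x (B y))"
      "cbounded C \<and> (\<forall>x y. cinner (A x) y = cinner x (C y))"
    then show "B = C" by (metis cinner_extR ext)
  qed
  from theI'[OF this] have p: "cbounded (cadj A) \<and> (\<forall>x y. cinner (A x) y = cinner x (cadj A y))"
    unfolding cadj_def .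
  then show "cbounded (cadj A)" "cinner (A x) y = cinner x (cadj A y)" by auto
  show "cinner (cadj A x) y = cinner x (A y)" using p by (metis cinner_commute)
qed

lemma cadj_eqI:
  assumes "cbounded A" "\<And>x y. cinner (A x) y = cinner x (B y)" shows "cadj A = B"
  by (rule ext, rule cinner_extR) (metis assms cadj)

lemma cadj_selfadj: "cselfadj A \<Longrightarrow> cadj A = A"
  by (rule cadj_eqI) (auto simp: cselfadj_def)

lemma cselfadj_cb: "cselfadj A \<Longrightarrow> cbounded A"
  by (simp add: cselfadj_def)

lemma cselfadjD: "cselfadj A \<Longrightarrow> cinner (A x) y = cinner x (A y)"
  by (simp add: cselfadj_def)

section \<open>Commutants\<close>

lemma commutant_cb: "A \<in> commutant F \<Longrightarrow> cbounded A"
  by (simp add: commutant_def)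

lemma commutantD: "A \<in> commutant F \<Longrightarrow> X \<in> F \<Longrightarrow> A (X x) = X (A x)"
  by (auto simp: commutant_def fun_eq_iff)

lemma commutantI: "cbounded A \<Longrightarrow> (\<And>X x. X \<in> F \<Longrightarrow> A (X x) = X (A x)) \<Longrightarrow> A \<in> commutant F"
  by (auto simp: commutant_def fun_eq_iff)

lemma commutant_anti: "F \<subseteq> G \<Longrightarrow> commutant G \<subseteq> commutant F"
  by (auto simp: commutant_def)

lemma double_commutant: "F \<subseteq> {A. cbounded A} \<Longrightarrow> F \<subseteq> commutant (commutant F)"
  by (fastforce simp: commutant_def)

lemma triple_commutant:
  assumes "F \<subseteq> {A. cbounded A}" shows "commutant (commutant (commutant F)) = commutant F"
proof
  show "commutant (commutant (commutant F)) \<subseteq> commutant F"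
    by (rule commutant_anti[OF double_commutant[OF assms]])
  show "commutant F \<subseteq> commutant (commutant (commutant F))"
    by (rule double_commutant) (auto simp: commutant_def)
qed

text \<open>Taking adjoints in the commutation of \<open>A\<close> with \<open>cadj X\<close> yields
  that of \<open>cadj A\<close> with \<open>X\<close>.\<close>

lemma commutant_cadj:
  assumes F: "\<And>X. X \<in> F \<Longrightarrow> cbounded X \<and> cadj X \<in> F" and A: "A \<in> commutant F"
  shows "cadj A \<in> commutant F"
proof (rule commutantI)
  note cA = commutant_cb[OF A]
  show "cbounded (cadj A)" by (rule cbounded_cadj[OF cA])
  fix X x assume X: "X \<in> F"
  show "cadj A (X x) = X (cadj A x)"
  proof (rule cinner_extR)
    fix z
    have "cinner z (cadj A (X x)) = cinner (cadj X (A z)) x"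
      using X F by (simp add: cadj[OF cA, symmetric] cadj')
    also have "\<dots> = cinner (A (cadj X z)) x" using commutantD[OF A] X F by simp
    also have "\<dots> = cinner z (X (cadj A x))" using X F by (simp add: cadj[OF cA] cadj')
    finally show "cinner z (cadj A (X x)) = cinner z (X (cadj A x))" .
  qed
qed

text \<open>Von Neumann algebras are defined through \<open>M = M''\<close>. Hence any such
  \<open>M\<close> above \<open>F\<close> contains \<open>F''\<close>, and \<open>F''\<close> is
  itself one of them; self-adjointness of \<open>F\<close> supplies its closure under
  adjoints.\<close>

lemma vN_gen_eq:
  fixes F :: "('a::chilbert \<Rightarrow> 'a) set"
  assumes F: "\<And>X. X \<in> F \<Longrightarrow> cselfadj X"
  shows "vN_gen F = commutant (commutant F)"
proof
  have Fb: "F \<subseteq> {A. cbounded A}" using F by (auto simp: cselfadj_def)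
  have star1: "cadj A \<in> commutant F" if "A \<in> commutant F" for A
    by (rule commutant_cadj[OF _ that]) (use F in \<open>auto simp: cadj_selfadj cselfadj_def\<close>)
  have star2: "cadj A \<in> commutant (commutant F)" if "A \<in> commutant (commutant F)" for A
    by (rule commutant_cadj[OF _ that]) (use star1 commutant_cb in auto)
  have "von_neumann_algebra (commutant (commutant F))"
    unfolding von_neumann_algebra_def
  proof (intro conjI ballI allI)
    show "commutant (commutant F) \<subseteq> {A. cbounded A}" by (auto simp: commutant_def)
    show "id \<in> commutant (commutant F)"
      by (rule commutantI) (auto simp: id_def cbounded_id)
    show "commutant (commutant (commutant (commutant F))) = commutant (commutant F)"
      using triple_commutant[OF Fb] by simp
    fix A C c assume A: "A \<in> commutant (commutant F)"
    note c = commutant_cb[OF A] commutantD[OF A]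
    show "(\<lambda>x. scaleC c (A x)) \<in> commutant (commutant F)"
      by (rule commutantI) (auto simp: c cbounded_ops cb_lin dest: commutant_cb)
    show "cadj A \<in> commutant (commutant F)" by (rule star2[OF A])
    assume C: "C \<in> commutant (commutant F)"
    note c = c commutant_cb[OF C] commutantD[OF C]
    show "(\<lambda>x. A x + C x) \<in> commutant (commutant F)"
      by (rule commutantI) (auto simp: c cbounded_ops cb_lin dest: commutant_cb)
    show "A \<circ> C \<in> commutant (commutant F)" unfolding o_def
      by (rule commutantI) (auto simp: c cbounded_ops)
  qed
  then show "vN_gen F \<subseteq> commutant (commutant F)"
    unfolding vN_gen_def using double_commutant[OF Fb] by auto
  show "commutant (commutant F) \<subseteq> vN_gen F"
  proof -
    have "commutant (commutant F) \<subseteq> M" if "von_neumann_algebra M" "F \<subseteq> M" for M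
      using commutant_anti[OF commutant_anti[OF that(2)]] that(1)
      by (simp add: von_neumann_algebra_def)
    then show ?thesis unfolding vN_gen_def by blast
  qed
qed

section \<open>Positive operators and square roots\<close>

lemma cselfadjI:
  assumes "cbounded A" "\<And>x y. cinner (A x) y = cinner x (A y)" shows "cselfadj A"
  using assms by (simp add: cselfadj_def)

text \<open>Self-adjointness is stored in place of the reality of the quadratic form, from which it
  follows by polarization.\<close>

definition pos_op :: "('a::chilbert \<Rightarrow> 'a) \<Rightarrow> bool" where
  "pos_op A \<longleftrightarrow> cselfadj A \<and> (\<forall>x. 0 \<le> Re (cinner x (A x)))"

text \<open>Polarization: reality of the form at \<open>x + y\<close> gives
  \<open>Im (p + q) = 0\<close>, and at \<open>x + \<i> y\<close> it gives
  \<open>Re (p - q) = 0\<close>.\<close>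

lemma cselfadj_if_form_real:
  fixes A :: "'a::chilbert \<Rightarrow> 'a"
  assumes A: "cbounded A" and z: "\<And>x. cinner x (A x) \<in> \<real>"
  shows "cselfadj A"
proof (rule cselfadjI[OF A])
  fix x y
  define p q where "p = cinner x (A y)" and "q = cinner y (A x)"
  have r: "Im (cinner x (A x)) = 0" for x using z[of x] by (simp add: complex_is_Real_iff)
  have "Im (cinner (x + y) (A (x + y))) = Im (cinner x (A x)) + Im (cinner y (A y)) + Im (p + q)"
    by (simp add: cb_lin[OF A] cinner_lin p_def q_def)
  then have 1: "Im (p + q) = 0" by (simp add: r)
  have "cinner (x + scaleC \<i> y) (A (x + scaleC \<i> y)) = cinner x (A x) + cinner y (A y) + \<i> * (p - q)"
    by (simp add: cb_lin[OF A] cinner_lin p_def q_def algebra_simps)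
  then have "Im (cinner x (A x) + cinner y (A y) + \<i> * (p - q)) = 0" using r by metis
  then have 2: "Re (p - q) = 0" by (simp add: r)
  have "p = cnj q" using 1 2 by (simp add: complex_eq_iff)
  then show "cinner (A x) y = cinner x (A y)"
    using cinner_commute[of "A x" y] by (simp add: p_def q_def)
qed

lemma cpositive_pos_op: "cpositive A \<Longrightarrow> pos_op A"
  using cselfadj_if_form_real[of A] by (auto simp: cpositive_def pos_op_def)

lemma pos_op_sa: "pos_op A \<Longrightarrow> cselfadj A"
  and pos_op_cb: "pos_op A \<Longrightarrow> cbounded A"
  and pos_opD: "pos_op A \<Longrightarrow> 0 \<le> Re (cinner x (A x))"
  by (auto simp: pos_op_def cselfadj_def)

lemma cselfadj_id: "cselfadj (\<lambda>x. x)"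
  and cselfadj_zero: "cselfadj (\<lambda>x. 0)"
  and cselfadj_add: "cselfadj A \<Longrightarrow> cselfadj C \<Longrightarrow> cselfadj (\<lambda>x. A x + C x)"
  and cselfadj_diff: "cselfadj A \<Longrightarrow> cselfadj C \<Longrightarrow> cselfadj (\<lambda>x. A x - C x)"
  and cselfadj_scaleR: "cselfadj A \<Longrightarrow> cselfadj (\<lambda>x. scaleR r (A x))"
  by (auto simp: cselfadj_def cbounded_ops cinner_lin)

lemma cselfadj_comp:
  "cselfadj A \<Longrightarrow> cselfadj C \<Longrightarrow> (\<And>x. A (C x) = C (A x)) \<Longrightarrow> cselfadj (\<lambda>x. A (C x))"
  by (auto simp: cselfadj_def cbounded_ops)

lemma cselfadj_sq: "cselfadj A \<Longrightarrow> cselfadj (\<lambda>x. A (A x))"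
  by (auto simp: cselfadj_def cbounded_ops)

lemma Re_cinner_sq: "cselfadj A \<Longrightarrow> Re (cinner x (A (A x))) = (norm (A x))\<^sup>2"
  by (metis cselfadjD cinner_self Re_complex_of_real)

text \<open>The operator inequality \<open>A\<^sup>2 \<le> K A\<close>, read off from positivity of
  the form at \<open>x - A x / K\<close>.\<close>

lemma pos_op_bound:
  assumes A: "pos_op A" and K: "K > 0" "\<And>x. norm (A x) \<le> K * norm x"
  shows "(norm (A x))\<^sup>2 \<le> K * Re (cinner x (A x))"
proof -
  note sa = pos_op_sa[OF A]
  note lin = cb_lin[OF pos_op_cb[OF A]]
  let ?y = "x - scaleR (1/K) (A x)"
  have "0 \<le> Re (cinner ?y (A ?y))" by (rule pos_opD[OF A])
  also have "\<dots> = Re (cinner x (A x)) - 2 / K * (norm (A x))\<^sup>2 + (1/K)\<^sup>2 * Re (cinner (A x) (A (A x)))"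
    by (simp add: lin cinner_lin cselfadjD[OF sa] Re_cinner_sq[OF sa] algebra_simps power2_eq_square)
  also have "Re (cinner (A x) (A (A x))) \<le> norm (A x) * norm (A (A x))"
    using cauchy_schwarz complex_Re_le_cmod order_trans by blast
  also have "\<dots> \<le> norm (A x) * (K * norm (A x))" by (intro mult_left_mono K) simp
  finally have "0 \<le> Re (cinner x (A x)) - 2 / K * (norm (A x))\<^sup>2 + (1/K)\<^sup>2 * (norm (A x) * (K * norm (A x)))"
    by (simp add: mult_left_mono)
  also have "\<dots> = Re (cinner x (A x)) - (norm (A x))\<^sup>2 / K"
    using K(1) by (simp add: field_simps power2_eq_square)
  finally show ?thesis using K(1) by (simp add: field_simps)
qed

lemma pos_op_null:
  assumes "pos_op A" "Re (cinner x (A x)) \<le> 0" shows "A x = 0"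
proof -
  obtain K where "K > 0" "\<And>x. norm (A x) \<le> K * norm x" using cb_pos_bound[OF pos_op_cb[OF assms(1)]] by blast
  from pos_op_bound[OF assms(1) this, of x] have "(norm (A x))\<^sup>2 \<le> 0"
    using assms(2) \<open>K > 0\<close> by (meson dual_order.trans mult_nonneg_nonpos less_imp_le)
  then show ?thesis by simp
qed

text \<open>The iteration \<open>Y \<mapsto> (C + Y\<^sup>2)/2\<close> from \<open>0\<close> increases to
  \<open>1 - (1 - C)\<^sup>1\<^sup>/\<^sup>2\<close>; its increments are dominated by those of the scalar iteration for \<open>C = 1\<close>,
  which converges because it is increasing and bounded by \<open>1\<close>.\<close>

primrec sqrt_iter :: "('a::chilbert \<Rightarrow> 'a) \<Rightarrow> nat \<Rightarrow> 'a \<Rightarrow> 'a" where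
  "sqrt_iter C 0 = (\<lambda>x. 0)"
| "sqrt_iter C (Suc n) = (\<lambda>x. scaleR (1/2) (C x + sqrt_iter C n (sqrt_iter C n x)))"

primrec sqrt_bound :: "nat \<Rightarrow> real" where
  "sqrt_bound 0 = 0"
| "sqrt_bound (Suc n) = (1 + (sqrt_bound n)\<^sup>2) / 2"

lemma sqrt_bound_range: "0 \<le> sqrt_bound n \<and> sqrt_bound n \<le> 1"
proof (induction n)
  case (Suc n)
  then have "(sqrt_bound n)\<^sup>2 \<le> 1" by (simp add: power_le_one)
  then show ?case by simp
qed simp

lemma sqrt_iter_commute:
  assumes X: "cbounded X" and "\<And>x. X (C x) = C (X x)"
  shows "X (sqrt_iter C n x) = sqrt_iter C n (X x)"
proof (induction n arbitrary: x)
  case (Suc n) then show ?case using assms by (simp add: cb_lin)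
qed (simp add: cb_lin[OF X])

lemma sqrt_iter_selfadj: assumes C: "cselfadj C" shows "cselfadj (sqrt_iter C n)"
  by (induction n) (auto intro!: cselfadj_zero cselfadj_scaleR cselfadj_add cselfadj_sq C)

lemma sqrt_iter_norm:
  assumes C: "\<And>x. norm (C x) \<le> norm x"
  shows "norm (sqrt_iter C n x) \<le> sqrt_bound n * norm x"
proof (induction n arbitrary: x)
  case (Suc n)
  have "norm (sqrt_iter C n (sqrt_iter C n x)) \<le> sqrt_bound n * (sqrt_bound n * norm x)"
    using order_trans[OF Suc mult_left_mono[OF Suc]] sqrt_bound_range by blast
  then have "norm (C x + sqrt_iter C n (sqrt_iter C n x)) \<le> norm x + (sqrt_bound n)\<^sup>2 * norm x"
    using norm_triangle_mono[OF C] by (simp add: power2_eq_square mult.assoc)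
  then show ?case unfolding sqrt_iter.simps sqrt_bound.simps norm_scaleR by (simp add: algebra_simps)
qed simp

lemma sqrt_bound_le_Suc: "sqrt_bound n \<le> sqrt_bound (Suc n)"
proof -
  have "sqrt_bound (Suc n) - sqrt_bound n = (1 - sqrt_bound n)\<^sup>2 / 2" by (simp add: field_simps power2_eq_square)
  moreover have "0 \<le> (1 - sqrt_bound n)\<^sup>2 / 2" by simp
  ultimately show ?thesis by linarith
qed

text \<open>Iterates commute, so the difference of the squares of two consecutive ones factors as
  \<open>(Z - Y) (Z + Y)\<close>. The scalar sequence satisfies the same identity with equality,
  which lets the induction close.\<close>

lemma sqrt_iter_step:
  assumes sa: "cselfadj C" and C: "\<And>x. norm (C x) \<le> norm x"
  shows "norm (sqrt_iter C (Suc n) x - sqrt_iter C n x) \<le> (sqrt_bound (Suc n) - sqrt_bound n) * norm x"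
proof (induction n arbitrary: x)
  case 0 then show ?case using C[of x] by simp
next
  case (Suc n)
  let ?Y = "sqrt_iter C n" and ?Z = "sqrt_iter C (Suc n)"
  let ?D = "\<lambda>x. ?Z x - ?Y x"
  have cb: "cbounded C" "cbounded ?Y" "cbounded ?Z" using sqrt_iter_selfadj[OF sa] sa cselfadj_cb by blast+
  have CY: "C (sqrt_iter C n x) = sqrt_iter C n (C x)" for n x
    using sqrt_iter_commute[of C C, OF cb(1)] by blast
  have ZY: "?Z (?Y x) = ?Y (?Z x)"
    using sqrt_iter_commute[of ?Y C "Suc n" x, OF cb(2) CY[symmetric]] by simp
  have D: "?D (?Z x + ?Y x) = ?Z (?Z x) - ?Y (?Y x)"
    by (simp only: cb_lin[OF cb(2)] cb_lin[OF cb(3)] ZY)  (simp add: algebra_simps)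
  have "sqrt_iter C (Suc (Suc n)) x - ?Z x = scaleR (1/2) (?Z (?Z x) - ?Y (?Y x))"
    unfolding sqrt_iter.simps(2)[of C "Suc n"] unfolding sqrt_iter.simps(2)[of C n]
    by (simp add: algebra_simps)
  then have e: "sqrt_iter C (Suc (Suc n)) x - ?Z x = scaleR (1/2) (?D (?Z x + ?Y x))" by (simp only: D)
  have "norm (?D (?Z x + ?Y x)) \<le> (sqrt_bound (Suc n) - sqrt_bound n) * norm (?Z x + ?Y x)" by (rule Suc)
  also have "\<dots> \<le> (sqrt_bound (Suc n) - sqrt_bound n) * ((sqrt_bound (Suc n) + sqrt_bound n) * norm x)"
  proof (rule mult_left_mono)
    show "norm (?Z x + ?Y x) \<le> (sqrt_bound (Suc n) + sqrt_bound n) * norm x"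
      using norm_triangle_mono[OF sqrt_iter_norm[OF C, of "Suc n" x] sqrt_iter_norm[OF C, of n x]]
      by (simp only: distrib_right)
    show "0 \<le> sqrt_bound (Suc n) - sqrt_bound n" using sqrt_bound_le_Suc[of n] by linarith
  qed
  also have "\<dots> = 2 * ((sqrt_bound (Suc (Suc n)) - sqrt_bound (Suc n)) * norm x)"
  proof -
    have "(a - b) * ((a + b) * c) = 2 * (((1 + a\<^sup>2) / 2 - (1 + b\<^sup>2) / 2) * c)" for a b c :: real
      by (simp add: field_simps power2_eq_square)
    then show ?thesis unfolding sqrt_bound.simps(2)[of "Suc n"] 
      by (metis sqrt_bound.simps(2)[of n])
  qed
  finally show ?case unfolding e by simp
qed

lemma sqrt_iter_diff:
  assumes sa: "cselfadj C" and C: "\<And>x. norm (C x) \<le> norm x"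
  shows "norm (sqrt_iter C (n + k) x - sqrt_iter C n x) \<le> (sqrt_bound (n + k) - sqrt_bound n) * norm x"
proof (induction k)
  case (Suc k)
  have "sqrt_iter C (n + Suc k) x - sqrt_iter C n x = (sqrt_iter C (Suc (n + k)) x - sqrt_iter C (n + k) x) + (sqrt_iter C (n + k) x - sqrt_iter C n x)"
    by (simp only: add_Suc_right) (simp del: sqrt_iter.simps)
  also have "norm \<dots> \<le> (sqrt_bound (Suc (n + k)) - sqrt_bound (n + k)) * norm x + (sqrt_bound (n + k) - sqrt_bound n) * norm x"
    by (rule norm_triangle_mono[OF sqrt_iter_step[OF assms] Suc])
  finally show ?case by (simp only: add_Suc_right) (simp add: algebra_simps del: sqrt_bound.simps)
qed simp

lemma Cauchy_sqrt_bound: "Cauchy sqrt_bound"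
proof -
  have "incseq sqrt_bound" by (rule incseq_SucI) (rule sqrt_bound_le_Suc)
  then obtain L where "sqrt_bound \<longlonglongrightarrow> L"
    using incseq_convergent[of sqrt_bound 1] sqrt_bound_range by blast
  then show ?thesis by (rule LIMSEQ_imp_Cauchy)
qed

lemma sqrt_iter_Cauchy:
  assumes sa: "cselfadj C" and C: "\<And>x. norm (C x) \<le> norm x"
  shows "Cauchy (\<lambda>n. sqrt_iter C n x)"
proof (rule metric_CauchyI)
  fix e :: real assume e: "e > 0"
  define d where "d = e / (norm x + 1)"
  have n: "norm x + 1 > 0" by (simp add: add_nonneg_pos)
  then have "d > 0" using e by (simp add: d_def)
  then obtain M where M: "\<And>m n. m \<ge> M \<Longrightarrow> n \<ge> M \<Longrightarrow> dist (sqrt_bound m) (sqrt_bound n) < d"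
    using metric_CauchyD[OF Cauchy_sqrt_bound] by blast
  have *: "dist (sqrt_iter C m x) (sqrt_iter C n x) < e" if "m \<ge> n" "n \<ge> M" for m n
  proof -
    have "dist (sqrt_iter C m x) (sqrt_iter C n x) \<le> (sqrt_bound m - sqrt_bound n) * norm x"
      using sqrt_iter_diff[OF assms, of n "m - n" x] that by (simp add: dist_norm)
    also have "\<dots> \<le> d * norm x"
      using M[of m n] that by (intro mult_right_mono) (auto simp: dist_real_def)
    also have "\<dots> < d * (norm x + 1)" using \<open>d > 0\<close> by simp
    also have "\<dots> = e" using n by (simp add: d_def)
    finally show ?thesis .
  qed
  show "\<exists>M. \<forall>m\<ge>M. \<forall>n\<ge>M. dist (sqrt_iter C m x) (sqrt_iter C n x) < e"
    using * by (metis dist_commute linear)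
qed

text \<open>The limit \<open>Y\<close> of the iteration satisfies
  \<open>2 Y = C + Y\<^sup>2\<close>, that is \<open>(1 - Y)\<^sup>2 = 1 - C\<close>. Commutation
  holds for each iterate and passes to the limit.\<close>

lemma sqrt_one_minus:
  fixes C :: "'a::chilbert \<Rightarrow> 'a"
  assumes sa: "cselfadj C" and C: "\<And>x. norm (C x) \<le> norm x"
  obtains R where "pos_op R" "\<And>x. R (R x) = x - C x"
    "\<And>X x. cbounded X \<Longrightarrow> (\<And>x. X (C x) = C (X x)) \<Longrightarrow> X (R x) = R (X x)"
proof -
  have "\<exists>l. (\<lambda>n. sqrt_iter C n x) \<longlonglongrightarrow> l" for x
    using sqrt_iter_Cauchy[OF assms, of x] by (simp add: Cauchy_convergent_iff convergent_def)
  then obtain Y where Y: "\<And>x. (\<lambda>n. sqrt_iter C n x) \<longlonglongrightarrow> Y x" by metis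
  have cbn: "cbounded (sqrt_iter C n)" for n using sqrt_iter_selfadj[OF sa] cselfadj_cb by blast
  have nn: "norm (sqrt_iter C n x) \<le> norm x" for n x
    using order_trans[OF sqrt_iter_norm[OF C] mult_right_mono[of "sqrt_bound n" 1 "norm x"]] sqrt_bound_range by simp
  have nY: "norm (Y x) \<le> norm x" for x
    by (rule LIMSEQ_le_const2[OF tendsto_norm[OF Y]]) (use nn in blast)
  have com: "X (Y x) = Y (X x)" if "cbounded X" "\<And>x. X (C x) = C (X x)" for X x
  proof (rule LIMSEQ_unique[OF cb_tendsto[OF that(1) Y]])
    show "(\<lambda>n. X (sqrt_iter C n x)) \<longlonglongrightarrow> Y (X x)"
      using Y[of "X x"] by (simp add: sqrt_iter_commute[of X C, OF that])
  qed
  have cbY: "cbounded Y"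
  proof (rule cboundedI[of _ 1])
    fix x y c
    show "Y (x + y) = Y x + Y y"
      by (rule LIMSEQ_unique[OF Y]) (simp add: cb_lin[OF cbn] tendsto_add Y)
    \<comment> \<open>Multiplication by a scalar is an operator commuting with \<open>C\<close>, so
      homogeneity is an instance of \<open>com\<close>.\<close>
    show "Y (scaleC c x) = scaleC c (Y x)"
      by (rule com[symmetric]) (auto intro: cbounded_scaleC cbounded_id simp: cb_lin cselfadj_cb[OF sa])
  qed (use nY in simp)
  have saY: "cselfadj Y"
  proof (rule cselfadjI[OF cbY])
    fix x y
    have "(\<lambda>n. cinner (sqrt_iter C n x) y) \<longlonglongrightarrow> cinner (Y x) y" by (intro tendsto_cinner Y tendsto_const)
    moreover have "(\<lambda>n. cinner x (sqrt_iter C n y)) \<longlonglongrightarrow> cinner x (Y y)" by (intro tendsto_cinner Y tendsto_const)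
    ultimately show "cinner (Y x) y = cinner x (Y y)"
      by (simp add: cselfadjD[OF sqrt_iter_selfadj[OF sa]] LIMSEQ_unique)
  qed
  \<comment> \<open>Both the operator and its argument vary with \<open>n\<close>. The iterates are
    contractions uniformly in \<open>n\<close>, so the argument may first be replaced by its limit
    \<open>Y x\<close>.\<close>
  have YY: "(\<lambda>n. sqrt_iter C n (sqrt_iter C n x)) \<longlonglongrightarrow> Y (Y x)" for x
  proof -
    have "(\<lambda>n. norm (sqrt_iter C n x - Y x)) \<longlonglongrightarrow> 0"
      using Y[of x] by (simp add: LIM_zero tendsto_norm_zero)
    then have "(\<lambda>n. sqrt_iter C n (sqrt_iter C n x - Y x)) \<longlonglongrightarrow> 0"
      by (rule Lim_null_comparison[rotated]) (simp add: nn)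
    from tendsto_add[OF this Y[of "Y x"]] show ?thesis by (simp add: cb_lin[OF cbn])
  qed
  have fixY: "scaleR 2 (Y x) = C x + Y (Y x)" for x
  proof -
    have "(\<lambda>n. sqrt_iter C (Suc n) x) \<longlonglongrightarrow> scaleR (1/2) (C x + Y (Y x))"
      unfolding sqrt_iter.simps by (intro tendsto_intros YY)
    from arg_cong[OF LIMSEQ_unique[OF LIMSEQ_Suc[OF Y] this], of "scaleR 2"] show ?thesis by simp
  qed
  show ?thesis
  proof (rule that[of "\<lambda>x. x - Y x"])
    have "0 \<le> Re (cinner x (x - Y x))" for x
    proof -
      have "Re (cinner x (Y x)) \<le> norm x * norm (Y x)"
        using cauchy_schwarz complex_Re_le_cmod order_trans by blast
      also have "\<dots> \<le> norm x * norm x" by (intro mult_left_mono nY) simp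
      finally show ?thesis by (simp add: cinner_lin cinner_self power2_eq_square)
    qed
    then show "pos_op (\<lambda>x. x - Y x)"
      unfolding pos_op_def by (intro conjI allI cselfadj_diff cselfadj_id saY)
    show "(x - Y x) - Y (x - Y x) = x - C x" for x
      using fixY[of x] by (simp add: cb_lin[OF cbY] scaleR_2 algebra_simps)
    show "X (x - Y x) = X x - Y (X x)" if "cbounded X" "\<And>x. X (C x) = C (X x)" for X x
      using com[OF that] by (simp add: cb_lin[OF that(1)])
  qed
qed

text \<open>After scaling, \<open>A / K = 1 - C\<close>, where \<open>pos_op_bound\<close> makes
  \<open>C\<close> a contraction; its root is multiplied back by \<open>sqrt K\<close>.\<close>

lemma sqrt_pos:
  fixes A :: "'a::chilbert \<Rightarrow> 'a"
  assumes A: "pos_op A"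
  obtains R where "pos_op R" "\<And>x. R (R x) = A x"
    "\<And>X x. cbounded X \<Longrightarrow> (\<And>x. X (A x) = A (X x)) \<Longrightarrow> X (R x) = R (X x)"
proof -
  obtain K where K: "K > 0" "\<And>x. norm (A x) \<le> K * norm x"
    using cb_pos_bound[OF pos_op_cb[OF A]] by blast
  define C where "C x = x - scaleR (1/K) (A x)" for x
  have sa: "cselfadj C" unfolding C_def
    by (intro cselfadj_diff cselfadj_id cselfadj_scaleR pos_op_sa A)
  have nC: "norm (C x) \<le> norm x" for x
  proof -
    have "(norm (C x))\<^sup>2 = (norm x)\<^sup>2 - 2 / K * Re (cinner x (A x)) + (norm (A x))\<^sup>2 / K\<^sup>2"
      by (simp add: C_def norm_sq_diff cinner_lin power_divide)
    also have "\<dots> \<le> (norm x)\<^sup>2 - 2 / K * Re (cinner x (A x)) + K * Re (cinner x (A x)) / K\<^sup>2"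
      using pos_op_bound[OF A K, of x] by (simp add: divide_right_mono)
    also have "\<dots> = (norm x)\<^sup>2 - Re (cinner x (A x)) / K"
      using K(1) by (simp add: power2_eq_square field_simps)
    also have "\<dots> \<le> (norm x)\<^sup>2" using K(1) pos_opD[OF A] by simp
    finally show ?thesis by (rule power2_le_imp_le) simp
  qed
  obtain R where R: "pos_op R" "\<And>x. R (R x) = x - C x"
    "\<And>X x. cbounded X \<Longrightarrow> (\<And>x. X (C x) = C (X x)) \<Longrightarrow> X (R x) = R (X x)"
    using sqrt_one_minus[OF sa nC] by blast
  note lin = cb_lin[OF pos_op_cb[OF R(1)]]
  show ?thesis
  proof (rule that[of "\<lambda>x. scaleR (sqrt K) (R x)"])
    show "pos_op (\<lambda>x. scaleR (sqrt K) (R x))"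
      using R(1) K(1) by (auto simp: pos_op_def cselfadj_scaleR cinner_lin)
    show "scaleR (sqrt K) (R (scaleR (sqrt K) (R x))) = A x" for x
      using K(1) by (simp add: lin R(2) C_def)
    show "X (scaleR (sqrt K) (R x)) = scaleR (sqrt K) (R (X x))"
      if "cbounded X" "\<And>x. X (A x) = A (X x)" for X x
      using R(3)[OF that(1)] that by (simp add: cb_lin[OF that(1)] C_def)
  qed
qed

text \<open>The root \<open>R\<close> of \<open>A\<close> commutes with \<open>C\<close>, so the
  form of the product at \<open>x\<close> is the form of \<open>C\<close> at
  \<open>R x\<close>.\<close>

lemma pos_op_comp:
  assumes A: "pos_op A" and C: "pos_op C" and com: "\<And>x. A (C x) = C (A x)"
  shows "pos_op (\<lambda>x. A (C x))"
proof -
  obtain R where R: "pos_op R" "\<And>x. R (R x) = A x"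
    "\<And>X x. cbounded X \<Longrightarrow> (\<And>x. X (A x) = A (X x)) \<Longrightarrow> X (R x) = R (X x)"
    using sqrt_pos[OF A] by blast
  have "cinner x (A (C x)) = cinner (R x) (C (R x))" for x
    using R(3)[OF pos_op_cb[OF C], of x] com
    by (simp add: R(2)[symmetric] cselfadjD[OF pos_op_sa[OF R(1)]])
  then show ?thesis unfolding pos_op_def
    using cselfadj_comp[OF pos_op_sa[OF A] pos_op_sa[OF C] com] pos_opD[OF C] by simp
qed

text \<open>In essence uniqueness of the positive root: the constructed root \<open>R\<close> of
  \<open>B\<^sup>2\<close> commutes with everything commuting with \<open>B\<^sup>2\<close>, and
  \<open>(R + B) (R - B) = 0\<close> forces \<open>R = B\<close>.\<close>

lemma commute_sq_imp:
  assumes B: "pos_op B" and X: "cbounded X" and c: "\<And>x. X (B (B x)) = B (B (X x))"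
  shows "X (B x) = B (X x)"
proof -
  note sa = pos_op_sa[OF B] note cb = pos_op_cb[OF B] note lin = cb_lin[OF cb]
  have "pos_op (\<lambda>x. B (B x))"
    using cselfadj_sq[OF sa] by (simp add: pos_op_def Re_cinner_sq[OF sa])
  then obtain R where R: "pos_op R" "\<And>x. R (R x) = B (B x)"
    "\<And>X x. cbounded X \<Longrightarrow> (\<And>x. X (B (B x)) = B (B (X x))) \<Longrightarrow> X (R x) = R (X x)"
    using sqrt_pos by blast
  note linR = cb_lin[OF pos_op_cb[OF R(1)]]
  have BR: "B (R x) = R (B x)" for x by (rule R(3)[OF cb]) simp
  have "R x = B x" for x
  proof -
    define y where "y = R x - B x"
    have "R y + B y = 0" by (simp add: y_def lin linR R(2) BR)
    then have "Re (cinner y (R y)) + Re (cinner y (B y)) = 0"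
      by (metis cinner_add_right cinner_zero_right plus_complex.sel(1) zero_complex.sel(1))
    then have "Re (cinner y (R y)) \<le> 0" "Re (cinner y (B y)) \<le> 0"
      using pos_opD[OF R(1), of y] pos_opD[OF B, of y] by linarith+
    then have "R y = 0" "B y = 0" using pos_op_null R(1) B by blast+
    \<comment> \<open>Both \<open>R\<close> and \<open>B\<close> annihilate
      \<open>y = (R - B) x\<close>; moving \<open>R - B\<close> to the other side of the inner
      product gives zero.\<close>
    then have "cinner y y = 0"
      unfolding y_def[of] using cselfadjD[OF sa] cselfadjD[OF pos_op_sa[OF R(1)]]
      by (simp add: y_def cinner_diff_left)
    then show ?thesis by (simp add: cinner_eq_zero_iff y_def)
  qed
  then show ?thesis using R(3)[OF X c] by simp
qed

section \<open>The diagonal entry of the symmetry\<close>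

text \<open>Solving \<open>B x = y\<close> means finding a fixed point of
  \<open>x \<mapsto> x - t (B x - y)\<close>, which is a strict contraction for a suitable
  \<open>t\<close>.\<close>

lemma selfadj_inverse:
  fixes B :: "'a::chilbert \<Rightarrow> 'a"
  assumes sa: "cselfadj B" and d: "d > 0" "\<And>x. d * (norm x)\<^sup>2 \<le> Re (cinner x (B x))"
  obtains I where "cselfadj I" "\<And>x. B (I x) = x" "\<And>x. I (B x) = x"
proof -
  note cb = cselfadj_cb[OF sa]
  note lin = cb_lin[OF cb]
  obtain K where K: "K > 0" "\<And>x. norm (B x) \<le> K * norm x" using cb_pos_bound[OF cb] by blast
  have lower: "d * norm x \<le> norm (B x)" for x
  proof (cases "x = 0")
    case False
    have "d * norm x * norm x \<le> norm x * norm (B x)"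
      using d(2)[of x] order_trans[OF complex_Re_le_cmod cauchy_schwarz[of x "B x"]]
      by (simp add: power2_eq_square mult.assoc)
    then show ?thesis using False by (simp add: mult.commute)
  qed simp
  have inj: "x = y" if "B x = B y" for x y
    using lower[of "x - y"] that d(1) by (simp add: lin mult_le_0_iff)
  \<comment> \<open>This \<open>t\<close> minimizes \<open>1 - 2 t d + t\<^sup>2 K\<^sup>2\<close>,
    the bound for the squared contraction factor.\<close>
  define t where "t = d / K\<^sup>2"
  have t: "t > 0" using d K by (simp add: t_def)
  \<comment> \<open>The \<open>max\<close> covers \<open>d > K\<close>, which is possible only on
    the zero space.\<close>
  define q where "q = sqrt (max 0 (1 - d\<^sup>2 / K\<^sup>2))"
  have q: "0 \<le> q" "q < 1" using d K by (auto simp: q_def)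
  have contr: "norm (x - scaleR t (B x)) \<le> q * norm x" for x
  proof -
    have "(norm (x - scaleR t (B x)))\<^sup>2 = (norm x)\<^sup>2 - 2 * t * Re (cinner x (B x)) + t\<^sup>2 * (norm (B x))\<^sup>2"
      using t by (simp add: norm_sq_diff cinner_lin power_mult_distrib)
    also have "\<dots> \<le> (norm x)\<^sup>2 - 2 * t * (d * (norm x)\<^sup>2) + t\<^sup>2 * (K * norm x)\<^sup>2"
      using t d(2)[of x] K(2)[of x] by (intro add_mono diff_mono mult_left_mono power_mono) auto
    also have "\<dots> = (1 - d\<^sup>2 / K\<^sup>2) * (norm x)\<^sup>2"
      using K(1) by (simp add: t_def field_simps power2_eq_square)
    also have "\<dots> \<le> q\<^sup>2 * (norm x)\<^sup>2" by (intro mult_right_mono) (auto simp: q_def)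
    finally have "(norm (x - scaleR t (B x)))\<^sup>2 \<le> (q * norm x)\<^sup>2" by (simp add: power_mult_distrib)
    then show ?thesis by (rule power2_le_imp_le) (use q in simp)
  qed
  have "\<exists>x. B x = y" for y
  proof -
    have "\<exists>!x. x - scaleR t (B x - y) = x"
    proof (rule banach_fix_type)
      have e: "(u - scaleR t (B u - y)) - (v - scaleR t (B v - y)) = (u - v) - scaleR t (B (u - v))" for u v
        by (simp add: lin algebra_simps)
      show "\<forall>u v. dist (u - scaleR t (B u - y)) (v - scaleR t (B v - y)) \<le> q * dist u v"
        unfolding dist_norm e using contr by blast
    qed (use q in auto)
    then show ?thesis using t by auto
  qed
  then obtain I where I: "\<And>y. B (I y) = y" by metis
  have IB: "I (B x) = x" for x by (rule inj) (rule I)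
  have "cselfadj I"
  proof (rule cselfadjI)
    show "cbounded I"
    proof (rule cboundedI[of _ "1 / d"])
      fix x y c
      show "I (x + y) = I x + I y" by (rule inj) (simp add: lin I)
      show "I (scaleC c x) = scaleC c (I x)" by (rule inj) (simp add: lin I)
      show "norm (I x) \<le> 1 / d * norm x" using lower[of "I x"] d(1) by (simp add: I field_simps)
    qed
    show "cinner (I x) y = cinner x (I y)" for x y
      using cselfadjD[OF sa, of "I x" "I y"] by (simp add: I)
  qed
  then show ?thesis using that I IB by blast
qed

lemma pos_op_add_scalar:
  assumes B: "pos_op B" and r: "r \<ge> 0"
  shows "pos_op (\<lambda>x. B x + scaleR r x)"
  using assms pos_opD[OF B] unfolding pos_op_def
  by (auto intro!: cselfadj_add cselfadj_scaleR cselfadj_id simp: cinner_lin cinner_self)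

text \<open>Both differences of squares factor into commuting positive operators, one of them
  \<open>B + r\<close>.\<close>

lemma pos_op_diff_sq:
  assumes B: "pos_op B" and r: "r \<ge> 0"
  shows pos_op_scalar_minus_sq: "pos_op (\<lambda>x. scaleR r x - B x) \<Longrightarrow> pos_op (\<lambda>x. scaleR (r\<^sup>2) x - B (B x))"
    and pos_op_sq_minus_scalar: "pos_op (\<lambda>x. B x - scaleR r x) \<Longrightarrow> pos_op (\<lambda>x. B (B x) - scaleR (r\<^sup>2) x)"
proof -
  note lin = cb_lin[OF pos_op_cb[OF B]]
  note p = pos_op_add_scalar[OF B r]
  show "pos_op (\<lambda>x. scaleR (r\<^sup>2) x - B (B x))" if "pos_op (\<lambda>x. scaleR r x - B x)"
    using pos_op_comp[OF that p] by (simp add: lin algebra_simps power2_eq_square)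
  show "pos_op (\<lambda>x. B (B x) - scaleR (r\<^sup>2) x)" if "pos_op (\<lambda>x. B x - scaleR r x)"
    using pos_op_comp[OF that p] by (simp add: lin algebra_simps power2_eq_square)
qed

lemma pos_op_add_scalar_inj:
  assumes B: "pos_op B" and r: "r > 0" and z: "B x + scaleR r x = 0"
  shows "x = 0"
proof -
  have "Re (cinner x (B x + scaleR r x)) = 0" using z by simp
  then have "Re (cinner x (B x)) + r * (norm x)\<^sup>2 = 0" by (simp add: cinner_lin cinner_self)
  moreover have "0 \<le> r * (norm x)\<^sup>2" using r by simp
  ultimately have "r * (norm x)\<^sup>2 = 0" using pos_opD[OF B, of x] by linarith
  then show ?thesis using r by simp
qed

text \<open>The diagonal entry \<open>a\<close> of the symmetry \<open>2Q - I\<close> is \<open>B + (1 - \<lambda>\<^sup>2)/4 B\<^sup>-\<^sup>1\<close>;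
  the bounds on \<open>B\<close> enter through
  \<open>B\<^sup>2 (1 - a\<^sup>2) = ((1 + \<bar>\<lambda>\<bar>)\<^sup>2/4 - B\<^sup>2) (B\<^sup>2 - (1 - \<bar>\<lambda>\<bar>)\<^sup>2/4)\<close>.\<close>

lemma symmetry_diagonal:
  fixes B :: "'k::chilbert \<Rightarrow> 'k" and lam :: real
  assumes lam: "lam \<noteq> -1"
    and B: "cpositive B"
    and B_lower: "op_less (\<lambda>x. scaleR (\<bar>1 - \<bar>lam\<bar>\<bar> / 2) x) B"
    and B_upper: "op_less B (\<lambda>x. scaleR ((1 + \<bar>lam\<bar>) / 2) x)"
  obtains a where "cselfadj a" "\<And>x. B (a x) = B (B x) + scaleR ((1 - lam\<^sup>2) / 4) x"
    "\<And>X x. cbounded X \<Longrightarrow> (\<And>x. X (B x) = B (X x)) \<Longrightarrow> X (a x) = a (X x)"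
    "pos_op (\<lambda>x. x - a (a x))" "\<And>x. a (a x) = x \<Longrightarrow> x = 0"
proof -
  define dl where "dl = \<bar>1 - \<bar>lam\<bar>\<bar> / 2"
  define be where "be = (1 + \<bar>lam\<bar>) / 2"
  define ka where "ka = (1 - lam\<^sup>2) / 4"
  have Bp: "pos_op B" by (rule cpositive_pos_op[OF B])
  note cb = pos_op_cb[OF Bp] note sa = pos_op_sa[OF Bp]
  note lin = cb_lin[OF cb]
  have low: "pos_op (\<lambda>x. B x - scaleR dl x)" "inj (\<lambda>x. B x - scaleR dl x)"
    and up: "pos_op (\<lambda>x. scaleR be x - B x)" "inj (\<lambda>x. scaleR be x - B x)"
    using B_lower B_upper cpositive_pos_op by (auto simp: op_less_def dl_def be_def)
  have lowi: "x = 0" if "B x = scaleR dl x" for x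
    using injD[OF low(2), of x 0] that by (simp add: lin)
  have upi: "x = 0" if "B x = scaleR be x" for x
    using injD[OF up(2), of x 0] that by (simp add: lin)
  have dl: "dl \<ge> 0" and be: "be > 0" by (auto simp: dl_def be_def intro: add_pos_nonneg)
  have D1: "pos_op (\<lambda>x. scaleR (be\<^sup>2) x - B (B x))"
    using pos_op_scalar_minus_sq[OF Bp _ up(1)] be by simp
  \<comment> \<open>\<open>be\<^sup>2 - B\<^sup>2 = (B + be) (be - B)\<close>, where both factors
    are injective.\<close>
  have D1i: "x = 0" if "scaleR (be\<^sup>2) x = B (B x)" for x
  proof (rule upi, rule ccontr)
    assume "B x \<noteq> scaleR be x"
    have "B (scaleR be x - B x) + scaleR be (scaleR be x - B x) = 0"
      using that by (simp add: lin algebra_simps power2_eq_square)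
    from pos_op_add_scalar_inj[OF Bp be this] show False using \<open>B x \<noteq> scaleR be x\<close> by simp
  qed
  show ?thesis
  \<comment> \<open>For \<open>lam = 1\<close> the inverse of \<open>B\<close> may be unbounded, but
    its coefficient is zero and \<open>a = B\<close>. For every other value the lower bound
    \<open>dl\<close> is positive and \<open>B\<close> has a bounded inverse.\<close>
  proof (cases "lam = 1")
    case True
    then have "be = 1" by (simp add: be_def)
    show ?thesis
      by (rule that[of B]) (use sa True D1 D1i \<open>be = 1\<close> in auto)
  next
    case False
    then have "\<bar>lam\<bar> \<noteq> 1" using lam by auto
    then have dl: "dl > 0" by (simp add: dl_def)
    have "dl * (norm x)\<^sup>2 \<le> Re (cinner x (B x))" for x
      using pos_opD[OF low(1), of x] by (simp add: cinner_lin cinner_self)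
    from selfadj_inverse[OF sa dl this]
    obtain I where I: "cselfadj I" "\<And>x. B (I x) = x" "\<And>x. I (B x) = x" by blast
    define a where "a x = B x + scaleR ka (I x)" for x
    have saa: "cselfadj a" unfolding a_def by (intro cselfadj_add cselfadj_scaleR sa I)
    note lina = cb_lin[OF cselfadj_cb[OF saa]]
    have Ba: "B (a x) = B (B x) + scaleR ka x" for x by (simp add: a_def lin I)
    have com: "X (a x) = a (X x)" if X: "cbounded X" "\<And>x. X (B x) = B (X x)" for X x
    proof -
      have "X (I x) = I (X x)" by (metis I(2,3) X(2))
      then show ?thesis by (simp add: a_def cb_lin[OF X(1)] X(2))
    qed
    have aB: "a (B x) = B (a x)" for x by (rule com[OF cb, symmetric]) simp
    have D2: "pos_op (\<lambda>x. B (B x) - scaleR (dl\<^sup>2) x)"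
      using pos_op_sq_minus_scalar[OF Bp _ low(1)] dl by simp
    have D2i: "x = 0" if "B (B x) = scaleR (dl\<^sup>2) x" for x
    proof (rule lowi, rule ccontr)
      assume "B x \<noteq> scaleR dl x"
      have "B (B x - scaleR dl x) + scaleR dl (B x - scaleR dl x) = 0"
        using that by (simp add: lin algebra_simps power2_eq_square)
      from pos_op_add_scalar_inj[OF Bp dl this] show False using \<open>B x \<noteq> scaleR dl x\<close> by simp
    qed
    \<comment> \<open>\<open>D = (be\<^sup>2 - B\<^sup>2) (B\<^sup>2 - dl\<^sup>2)\<close>, a
      product of commuting factors, each positive and injective. The constants below identify it
      with \<open>B\<^sup>2 (1 - a\<^sup>2)\<close>.\<close>
    define D where "D x = scaleR (be\<^sup>2) (B (B x) - scaleR (dl\<^sup>2) x) - B (B (B (B x) - scaleR (dl\<^sup>2) x))" for x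
    have D: "pos_op D" unfolding D_def
      by (rule pos_op_comp[OF D1 D2]) (simp add: lin algebra_simps)
    have c1: "be\<^sup>2 + dl\<^sup>2 = 1 - ka - ka" and c2: "be\<^sup>2 * dl\<^sup>2 = ka\<^sup>2"
    proof -
      have "\<bar>lam\<bar>\<^sup>2 = lam\<^sup>2" by simp
      then show "be\<^sup>2 + dl\<^sup>2 = 1 - ka - ka"
        by (simp add: be_def dl_def ka_def power_divide power2_eq_square algebra_simps add_divide_distrib diff_divide_distrib)
      have "be * dl = \<bar>ka\<bar>"
      proof -
        have "be * dl = \<bar>(1 + \<bar>lam\<bar>) * (1 - \<bar>lam\<bar>)\<bar> / 4"
          by (simp add: be_def dl_def abs_mult)
        also have "(1 + \<bar>lam\<bar>) * (1 - \<bar>lam\<bar>) = 1 - lam\<^sup>2"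
          by (simp add: algebra_simps power2_eq_square)
        finally show ?thesis by (simp add: ka_def)
      qed
      then show "be\<^sup>2 * dl\<^sup>2 = ka\<^sup>2" by (metis power2_abs power_mult_distrib)
    qed
    have key: "B (B (x - a (a x))) = D x" for x
    proof -
      have "B (B (a (a x))) = B (a (B (a x)))" by (simp only: aB)
      also have "\<dots> = B (B (B (B x))) + scaleR ka (B (B x)) + scaleR ka (B (B x)) + scaleR (ka\<^sup>2) x"
        by (simp add: Ba lin lina algebra_simps power2_eq_square aB)
      finally have q: "B (B (a (a x))) = B (B (B (B x))) + scaleR ka (B (B x)) + scaleR ka (B (B x)) + scaleR (ka\<^sup>2) x" .
      have "B (B (x - a (a x))) = scaleR (1 - ka - ka) (B (B x)) - B (B (B (B x))) - scaleR (ka\<^sup>2) x"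
        unfolding cb_diff[OF cb] q scaleR_diff_left scaleR_one by (simp add: algebra_simps)
      also have "\<dots> = D x" unfolding D_def c1[symmetric] c2[symmetric]
        by (simp add: lin algebra_simps)
      finally show ?thesis .
    qed
    show ?thesis
    proof (rule that[of a])
      show "pos_op (\<lambda>x. x - a (a x))"
        unfolding pos_op_def
      proof (intro conjI allI)
        show "cselfadj (\<lambda>x. x - a (a x))" by (intro cselfadj_diff cselfadj_id cselfadj_sq saa)
        fix x
        \<comment> \<open>Writing \<open>x = B y\<close> transfers positivity from
          \<open>B\<^sup>2 (1 - a\<^sup>2)\<close> to \<open>1 - a\<^sup>2\<close>.\<close>
        define y where "y = I x"
        have x: "x = B y" by (simp add: y_def I)
        have "cinner x (x - a (a x)) = cinner y (D y)"
          unfolding key[symmetric] by (simp add: x cselfadjD[OF sa] lin aB)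
        then show "0 \<le> Re (cinner x (x - a (a x)))" using pos_opD[OF D] by simp
      qed
      fix x assume "a (a x) = x"
      then have "D x = 0" using key[of x] by (simp add: lin)
      then have "B (B x) - scaleR (dl\<^sup>2) x = 0" unfolding D_def by (intro D1i) simp
      then show "x = 0" by (intro D2i) simp
    qed (use saa Ba com ka_def in auto)
  qed
qed

section \<open>Unitaries in a commutant\<close>

definition unitary_op :: "('a::chilbert \<Rightarrow> 'a) \<Rightarrow> bool" where
  "unitary_op u \<longleftrightarrow> cbounded u \<and> (\<forall>x. u (cadj u x) = x) \<and> (\<forall>x. cadj u (u x) = x)"

text \<open>A self-adjoint contraction \<open>h\<close> is the real part of the unitary
  \<open>h + i (1 - h\<^sup>2)\<^sup>1\<^sup>/\<^sup>2\<close>.\<close>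

lemma commute_unitaries:
  fixes X :: "'a::chilbert \<Rightarrow> 'a"
  assumes F: "\<And>A. A \<in> F \<Longrightarrow> cselfadj A" and X: "cbounded X"
    and u: "\<And>u x. u \<in> commutant F \<Longrightarrow> unitary_op u \<Longrightarrow> X (u x) = u (X x)"
    and Z: "Z \<in> commutant F"
  shows "X (Z x) = Z (X x)"
proof -
  note lin = cb_lin[OF X]
  have star: "cadj A \<in> commutant F" if "A \<in> commutant F" for A
    by (rule commutant_cadj[OF _ that]) (use F in \<open>auto simp: cadj_selfadj cselfadj_def\<close>)
  have contraction: "X (h x) = h (X x)"
    if h: "h \<in> commutant F" "cselfadj h" "\<And>x. norm (h x) \<le> norm x" for h x
  proof -
    have "norm (h (h x)) \<le> norm x" for x using h(3) order_trans by blast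
    from sqrt_one_minus[OF cselfadj_sq[OF h(2)] this]
    obtain R where R: "pos_op R" "\<And>x. R (R x) = x - h (h x)"
      "\<And>X x. cbounded X \<Longrightarrow> (\<And>x. X (h (h x)) = h (h (X x))) \<Longrightarrow> X (R x) = R (X x)"
      by blast
    note cbR = pos_op_cb[OF R(1)] and cbh = commutant_cb[OF h(1)]
    note linR = cb_lin[OF cbR] and linh = cb_lin[OF cbh]
    have Rh: "R (h x) = h (R x)" for x by (rule R(3)[OF cbh, symmetric]) simp
    have RF: "R (A x) = A (R x)" if "A \<in> F" for A x
      by (rule R(3)[symmetric]) (use cselfadj_cb[OF F[OF that]] commutantD[OF h(1) that] in auto)
    \<comment> \<open>The parameter \<open>s\<close> takes the values \<open>1\<close> and
      \<open>-1\<close>: these two unitaries are adjoint to each other, and \<open>h\<close> is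
      their mean.\<close>
    define w where "w s x = h x + scaleC (s * \<i>) (R x)" for s x
    have cbw: "cbounded (w s)" for s unfolding w_def by (intro cbounded_intros cbh cbR)
    have wF: "w s \<in> commutant F" for s
    proof (rule commutantI[OF cbw])
      fix A x assume A: "A \<in> F"
      show "w s (A x) = A (w s x)"
        by (simp add: w_def RF[OF A] commutantD[OF h(1) A] cb_lin[OF cselfadj_cb[OF F[OF A]]])
    qed
    have adj: "cadj (w s) = w (- s)" if "s \<in> \<real>" for s
      using that by (intro cadj_eqI[OF cbw])
        (auto simp: w_def cinner_lin cselfadjD[OF h(2)] cselfadjD[OF pos_op_sa[OF R(1)]] Reals_cnj_iff)
    have prod: "w s (w (- s) x) = x" if "s = 1 \<or> s = -1" for s x
      using that by (auto simp: w_def linR linh R(2) Rh scaleC_add_right scaleC_scaleC scaleC_one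
          scaleC_minus_left scaleC_minus_right scaleC_diff_right)
    have "unitary_op (w 1)" "unitary_op (w (-1))"
      unfolding unitary_op_def using cbw adj[of 1] adj[of "-1"] prod[of 1] prod[of "-1"] by auto
    then have c: "X (w 1 x) = w 1 (X x)" "X (w (-1) x) = w (-1) (X x)" for x using u wF by auto
    have "h x = scaleR (1/2) (w 1 x + w (-1) x)" for x
      by (simp add: w_def scaleC_minus_left scaleR_2[symmetric])
    then show ?thesis by (simp add: lin c)
  qed
  have selfadj: "X (h x) = h (X x)" if h: "h \<in> commutant F" "cselfadj h" for h x
  proof -
    obtain K where K: "K > 0" "\<And>x. norm (h x) \<le> K * norm x" using cb_pos_bound[OF commutant_cb[OF h(1)]] by blast
    have "X (scaleR (1/K) (h x)) = scaleR (1/K) (h (X x))"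
    proof (rule contraction)
      show "(\<lambda>x. scaleR (1/K) (h x)) \<in> commutant F"
      proof (rule commutantI)
        fix A x assume A: "A \<in> F"
        show "scaleR (1/K) (h (A x)) = A (scaleR (1/K) (h x))"
          by (simp add: commutantD[OF h(1) A] cb_lin[OF cselfadj_cb[OF F[OF A]]])
      qed (intro cbounded_scaleR commutant_cb[OF h(1)])
      show "cselfadj (\<lambda>x. scaleR (1/K) (h x))" by (intro cselfadj_scaleR h)
      show "norm (scaleR (1/K) (h x)) \<le> norm x" for x using K by (simp add: field_simps)
    qed
    then show ?thesis using K(1) by (simp add: lin)
  qed
  let ?Z = "cadj Z"
  note cbZ = commutant_cb[OF Z] commutant_cb[OF star[OF Z]]
  note adj = cadj[OF cbZ(1)] cadj'[OF cbZ(1)]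
  have mem: "(\<lambda>x. scaleC c (Z x) + scaleC d (?Z x)) \<in> commutant F" for c d
  proof (rule commutantI)
    show "cbounded (\<lambda>x. scaleC c (Z x) + scaleC d (?Z x))" by (intro cbounded_intros cbZ)
    fix A x assume A: "A \<in> F"
    show "scaleC c (Z (A x)) + scaleC d (?Z (A x)) = A (scaleC c (Z x) + scaleC d (?Z x))"
      by (simp add: commutantD[OF Z A] commutantD[OF star[OF Z] A] cb_lin[OF cselfadj_cb[OF F[OF A]]])
  qed
  have sa: "cselfadj (\<lambda>x. scaleC c (Z x) + scaleC (cnj c) (?Z x))" for c
    by (rule cselfadjI[OF commutant_cb[OF mem]]) (simp add: cinner_lin adj)
  have c: "X (scaleC c (Z x) + scaleC (cnj c) (?Z x)) = scaleC c (Z (X x)) + scaleC (cnj c) (?Z (X x))" for c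
    by (rule selfadj[OF mem sa])
  \<comment> \<open>Cartesian decomposition of \<open>Z\<close>: the two brackets are the
    self-adjoint operators of \<open>sa\<close> for \<open>c = 1\<close> and
    \<open>c = \<i>\<close>.\<close>
  have e: "scaleR 2 (Z x) = (scaleC 1 (Z x) + scaleC (cnj 1) (?Z x)) - scaleC \<i> (scaleC \<i> (Z x) + scaleC (cnj \<i>) (?Z x))" for x
    by (simp add: scaleC_add_right scaleC_diff_right scaleC_scaleC scaleC_minus_left scaleC_minus_right scaleC_one scaleR_2)
  have "X (scaleR 2 (Z x)) = scaleR 2 (Z (X x))"
    unfolding e by (simp only: cb_diff[OF X]
        cb_scaleC[OF X, of \<i> "scaleC \<i> (Z x) + scaleC (cnj \<i>) (?Z x)"] c)
  then show ?thesis by (simp add: lin)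
qed

section \<open>Operator matrices on a reducing subspace\<close>

text \<open>The vector identities behind idempotence in \<open>lift_cproj\<close>. In the first one
  \<open>a, p, q\<close> stand for a component and its images under \<open>w\<close> and
  \<open>w\<^sup>2\<close>, while \<open>e, f\<close> are the off-diagonal contributions.\<close>

lemma projection_entries:
  fixes a :: "'b::real_vector"
  shows "scaleR (1/2) ((scaleR (1/2) (a + p) + scaleR (1/2) e) + (scaleR (1/2) (p + q) + scaleR (1/2) f))
      + scaleR (1/2) (scaleR (1/2) (a - q) + scaleR (1/2) (e - f)) = scaleR (1/2) (a + p) + scaleR (1/2) e"
    and "scaleR (1/2) (scaleR (1/2) (e + f) + scaleR (1/2) (a - q))
      + scaleR (1/2) ((scaleR (1/2) e + scaleR (1/2) (a - p)) - (scaleR (1/2) f + scaleR (1/2) (p - q)))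
      = scaleR (1/2) e + scaleR (1/2) (a - p)"
proof -
  have h: "scaleR (1/2) z = scaleR (1/4) z + scaleR (1/4) z" for z :: 'b
    by (simp add: scaleR_add_left[symmetric])
  show "scaleR (1/2) ((scaleR (1/2) (a + p) + scaleR (1/2) e) + (scaleR (1/2) (p + q) + scaleR (1/2) f))
      + scaleR (1/2) (scaleR (1/2) (a - q) + scaleR (1/2) (e - f)) = scaleR (1/2) (a + p) + scaleR (1/2) e"
    by (simp add: scaleR_add_right scaleR_diff_right) (simp add: h)
  show "scaleR (1/2) (scaleR (1/2) (e + f) + scaleR (1/2) (a - q))
      + scaleR (1/2) ((scaleR (1/2) e + scaleR (1/2) (a - p)) - (scaleR (1/2) f + scaleR (1/2) (p - q)))
      = scaleR (1/2) e + scaleR (1/2) (a - p)"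
    by (simp add: scaleR_add_right scaleR_diff_right) (simp add: h)
qed

locale pair_decomposition =
  fixes U :: "'k::chilbert \<times> 'k \<Rightarrow> 'a::chilbert" and S :: "'a set"
  assumes U: "pair_unitary U S" and S: "csubsp S"
begin

lemma U_add: "U (x, y) + U (x', y') = U (x + x', y + y')"
  and U_scaleC: "scaleC c (U (x, y)) = U (scaleC c x, scaleC c y)"
  and U_cinner: "cinner (U (x, y)) (U (x', y')) = cinner x x' + cinner y y'"
  and U_range: "range U = S"
  using U unfolding pair_unitary_def by metis+

lemma U_in: "U p \<in> S" using U_range by blast

lemma U_scaleR: "scaleR r (U (x, y)) = U (scaleR r x, scaleR r y)"
  by (simp add: scaleR_scaleC U_scaleC)

lemma U_minus: "- U (x, y) = U (- x, - y)"
  using U_scaleR[of "-1" x y] by simp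

lemma U_diff: "U (x, y) - U (x', y') = U (x - x', y - y')"
  using U_add[of x y "- x'" "- y'"] by (simp add: U_minus[symmetric])

lemma U_zero: "U (0, 0) = 0"
  using U_scaleR[of 0 0 0] by simp

lemma U_norm: "(norm (U (x, y)))\<^sup>2 = (norm x)\<^sup>2 + (norm y)\<^sup>2"
  using U_cinner[of x y x y] unfolding cinner_self by (metis of_real_add of_real_eq_iff)

lemma U_norm_le: "norm (U (x, y)) \<le> norm x + norm y"
proof (rule power2_le_imp_le)
  show "(norm (U (x, y)))\<^sup>2 \<le> (norm x + norm y)\<^sup>2"
    by (simp add: U_norm power2_sum)
qed simp

lemma U_inj: "U (x, y) = U (x', y') \<longleftrightarrow> x = x' \<and> y = y'"
proof
  assume "U (x, y) = U (x', y')"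
  then have "U (x - x', y - y') = 0" by (simp add: U_diff[symmetric])
  then have "(norm (x - x'))\<^sup>2 + (norm (y - y'))\<^sup>2 = 0" by (simp add: U_norm[symmetric])
  then show "x = x' \<and> y = y'" by (simp add: sum_power2_eq_zero_iff)
qed simp

text \<open>The pair of coordinates of the orthogonal projection onto \<open>S\<close>; in other
  words \<open>J\<close> is the adjoint of \<open>U\<close>, as \<open>U_cinner_J\<close> confirms.
  The choice is unique because \<open>U\<close> is injective.\<close>

definition J :: "'a \<Rightarrow> 'k \<times> 'k" where "J x = (SOME p. U p = projon S x)"
definition J1 :: "'a \<Rightarrow> 'k" where "J1 x = fst (J x)"
definition J2 :: "'a \<Rightarrow> 'k" where "J2 x = snd (J x)"

lemma UJ: "U (J1 x, J2 x) = projon S x"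
proof -
  have "projon S x \<in> range U" using projon_in[OF S] U_range by blast
  then have "\<exists>p. U p = projon S x" by (metis rangeE)
  from someI_ex[OF this] show ?thesis by (simp add: J1_def J2_def J_def)
qed

lemma J_eqI: "U (u, v) = projon S x \<Longrightarrow> J1 x = u \<and> J2 x = v"
  using UJ[of x] by (metis U_inj)

lemma JU: "J1 (U (u, v)) = u" "J2 (U (u, v)) = v"
  using J_eqI[of u v "U (u, v)"] projon_fix[OF S U_in] by auto

lemma J_add: "J1 (x + y) = J1 x + J1 y" "J2 (x + y) = J2 x + J2 y"
  using J_eqI[of "J1 x + J1 y" "J2 x + J2 y" "x + y"]
  by (auto simp: U_add[symmetric] UJ cb_lin[OF projon_cbounded[OF S]])

lemma J_scaleC: "J1 (scaleC c x) = scaleC c (J1 x)" "J2 (scaleC c x) = scaleC c (J2 x)"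
  using J_eqI[of "scaleC c (J1 x)" "scaleC c (J2 x)" "scaleC c x"]
  by (auto simp: U_scaleC[symmetric] UJ cb_lin[OF projon_cbounded[OF S]])

lemma U_cinner_J: "cinner (U (u, v)) x = cinner u (J1 x) + cinner v (J2 x)"
proof -
  have "cinner (U (u, v)) x = cinner (U (u, v)) (projon S x)"
    using projon_orth[OF S U_in, of "(u, v)" x] by (simp add: cinner_diff_right)
  then show ?thesis by (simp add: UJ[symmetric] U_cinner)
qed

lemma J_cinner_U: "cinner x (U (u, v)) = cinner (J1 x) u + cinner (J2 x) v"
  using U_cinner_J[of u v x] by (metis cinner_commute complex_cnj_add)

lemma J_norm: "norm (J1 x) \<le> norm x" "norm (J2 x) \<le> norm x"
proof -
  have "cinner (projon S x) (projon S x) = cinner (projon S x) x"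
    using projon_orth[OF S projon_in[OF S], of x x] by (simp add: cinner_diff_right)
  then have "(norm (projon S x))\<^sup>2 = cmod (cinner (projon S x) x)" by (simp add: cmod_cinner_self[symmetric])
  also have "\<dots> \<le> norm (projon S x) * norm x" by (rule cauchy_schwarz)
  finally have p: "norm (projon S x) \<le> norm x"
    by (cases "projon S x = 0") (auto simp: power2_eq_square)
  then have "(norm (projon S x))\<^sup>2 \<le> (norm x)\<^sup>2" by (rule power_mono) simp
  then have "(norm (J1 x))\<^sup>2 + (norm (J2 x))\<^sup>2 \<le> (norm x)\<^sup>2" by (simp add: UJ[symmetric] U_norm)
  moreover have "0 \<le> (norm (J1 x))\<^sup>2" "0 \<le> (norm (J2 x))\<^sup>2" by simp_all
  ultimately have "(norm (J1 x))\<^sup>2 \<le> (norm x)\<^sup>2" "(norm (J2 x))\<^sup>2 \<le> (norm x)\<^sup>2" by linarith+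
  then show "norm (J1 x) \<le> norm x" "norm (J2 x) \<le> norm x"
    by (auto intro: power2_le_imp_le[OF _ norm_ge_zero])
qed

lemma J_orth:
  assumes "\<And>y. y \<in> S \<Longrightarrow> cinner y x = 0" shows "J1 x = 0" "J2 x = 0"
  using J_eqI[of 0 0 x] projon_zero[OF S assms] U_zero by auto

lemma entry_cbounded:
  assumes X: "cbounded X"
  shows "cbounded (\<lambda>u. J1 (X (U (u, 0))))" "cbounded (\<lambda>u. J2 (X (U (u, 0))))"
    "cbounded (\<lambda>u. J1 (X (U (0, u))))" "cbounded (\<lambda>u. J2 (X (U (0, u))))"
proof -
  obtain K where K: "K > 0" "\<And>x. norm (X x) \<le> K * norm x" using cb_pos_bound[OF X] by blast
  have n: "norm (U (u, 0)) \<le> norm u" "norm (U (0, u)) \<le> norm u" for u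
    using U_norm_le[of u 0] U_norm_le[of 0 u] by auto
  have b: "norm (X (U (u, 0))) \<le> K * norm u" "norm (X (U (0, u))) \<le> K * norm u" for u
    using order_trans[OF K(2) mult_left_mono[OF n(1)]] order_trans[OF K(2) mult_left_mono[OF n(2)]] K(1)
    by (meson less_imp_le)+
  have a: "U (x + y, 0) = U (x, 0) + U (y, 0)" "U (0, x + y) = U (0, x) + U (0, y)"
    "U (scaleC c x, 0) = scaleC c (U (x, 0))" "U (0, scaleC c x) = scaleC c (U (0, x))" for x y c
    by (simp_all add: U_add U_scaleC)
  show "cbounded (\<lambda>u. J1 (X (U (u, 0))))" "cbounded (\<lambda>u. J2 (X (U (u, 0))))"
    "cbounded (\<lambda>u. J1 (X (U (0, u))))" "cbounded (\<lambda>u. J2 (X (U (0, u))))"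
    by (rule cboundedI[of _ K]; auto simp: a J_add J_scaleC cb_lin[OF X] intro: order_trans[OF J_norm(1) b(1)]
        order_trans[OF J_norm(1) b(2)] order_trans[OF J_norm(2) b(1)] order_trans[OF J_norm(2) b(2)])+
qed

lemma entries:
  assumes X: "cbounded X" and inv: "\<And>x. x \<in> S \<Longrightarrow> X x \<in> S"
  obtains X11 X12 X21 X22 where "cbounded X11" "cbounded X12" "cbounded X21" "cbounded X22"
    "\<And>u v. X (U (u, v)) = U (X11 u + X12 v, X21 u + X22 v)"
proof -
  have "X (U (u, v)) = U (J1 (X (U (u, 0))) + J1 (X (U (0, v))), J2 (X (U (u, 0))) + J2 (X (U (0, v))))" for u v
  proof -
    have "X (U (u, v)) = X (U (u, 0)) + X (U (0, v))"
      by (simp add: cb_add[OF X, symmetric] U_add)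
    moreover have "X (U p) = U (J1 (X (U p)), J2 (X (U p)))" for p
      by (simp add: UJ projon_fix[OF S inv[OF U_in]])
    ultimately show ?thesis by (metis U_add)
  qed
  then show ?thesis using that entry_cbounded[OF X] by blast
qed

text \<open>The operator matrix carried over to \<open>S\<close> by \<open>U\<close> and extended by
  zero to the orthogonal complement.\<close>

definition lift :: "('k \<Rightarrow> 'k) \<Rightarrow> ('k \<Rightarrow> 'k) \<Rightarrow> ('k \<Rightarrow> 'k) \<Rightarrow> ('k \<Rightarrow> 'k) \<Rightarrow> 'a \<Rightarrow> 'a" where
  "lift A11 A12 A21 A22 x = U (A11 (J1 x) + A12 (J2 x), A21 (J1 x) + A22 (J2 x))"

lemma lift_U: "lift A11 A12 A21 A22 (U (u, v)) = U (A11 u + A12 v, A21 u + A22 v)"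
  by (simp add: lift_def JU)

lemma lift_orth:
  assumes "cbounded A11" "cbounded A12" "cbounded A21" "cbounded A22" "\<And>y. y \<in> S \<Longrightarrow> cinner y x = 0"
  shows "lift A11 A12 A21 A22 x = 0"
  using assms by (simp add: lift_def J_orth cb_zero U_zero)

lemma lift_in: "lift A11 A12 A21 A22 x \<in> S"
  by (simp add: lift_def U_in)

lemma lift_cbounded:
  assumes "cbounded A11" "cbounded A12" "cbounded A21" "cbounded A22"
  shows "cbounded (lift A11 A12 A21 A22)"
proof -
  have p: "\<exists>K>0. \<forall>y x. norm y \<le> norm x \<longrightarrow> norm (A y) \<le> K * norm (x::'a)" if A: "cbounded A" for A :: "'k \<Rightarrow> 'k"
  proof -
    obtain K where "K > 0" "\<And>x. norm (A x) \<le> K * norm x" using cb_pos_bound[OF A] by blast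
    then show ?thesis by (meson less_imp_le mult_left_mono order_trans)
  qed
  obtain K11 where 11: "\<And>y x. norm y \<le> norm x \<Longrightarrow> norm (A11 y) \<le> K11 * norm (x::'a)" using p[OF assms(1)] by blast
  obtain K12 where 12: "\<And>y x. norm y \<le> norm x \<Longrightarrow> norm (A12 y) \<le> K12 * norm (x::'a)" using p[OF assms(2)] by blast
  obtain K21 where 21: "\<And>y x. norm y \<le> norm x \<Longrightarrow> norm (A21 y) \<le> K21 * norm (x::'a)" using p[OF assms(3)] by blast
  obtain K22 where 22: "\<And>y x. norm y \<le> norm x \<Longrightarrow> norm (A22 y) \<le> K22 * norm (x::'a)" using p[OF assms(4)] by blast
  show ?thesis
  proof (rule cboundedI[of _ "K11 + K12 + K21 + K22"])
    fix x y c
    show "lift A11 A12 A21 A22 (x + y) = lift A11 A12 A21 A22 x + lift A11 A12 A21 A22 y"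
      by (simp add: lift_def J_add U_add assms[THEN cb_add] algebra_simps)
    show "lift A11 A12 A21 A22 (scaleC c x) = scaleC c (lift A11 A12 A21 A22 x)"
      by (simp add: lift_def J_scaleC U_scaleC assms[THEN cb_scaleC] scaleC_add_right)
    have "norm (lift A11 A12 A21 A22 x) \<le> norm (A11 (J1 x) + A12 (J2 x)) + norm (A21 (J1 x) + A22 (J2 x))"
      unfolding lift_def by (rule U_norm_le)
    also have "\<dots> \<le> (K11 * norm x + K12 * norm x) + (K21 * norm x + K22 * norm x)"
      by (intro add_mono norm_triangle_mono 11 12 21 22 J_norm)
    finally show "norm (lift A11 A12 A21 A22 x) \<le> (K11 + K12 + K21 + K22) * norm x"
      by (simp add: algebra_simps)
  qed
qed

text \<open>The matrix is \<open>(1 + V) / 2\<close> for the self-adjoint \<open>V\<close> with rows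
  \<open>(w, d u)\<close> and \<open>(d u\<^sup>*, -w)\<close>. The commutation rules cancel the
  off-diagonal entries of \<open>V\<^sup>2\<close>, and \<open>w\<^sup>2 + d\<^sup>2 = 1\<close>
  makes its diagonal the identity.\<close>

lemma lift_cproj:
  assumes w: "cselfadj w" and d: "cselfadj d" and u: "unitary_op u"
    and wd: "\<And>x. w (d x) = d (w x)" and wu: "\<And>x. w (u x) = u (w x)" and du: "\<And>x. d (u x) = u (d x)"
    and sq: "\<And>x. w (w x) + d (d x) = x"
  shows "cproj (lift (\<lambda>x. scaleR (1/2) (x + w x)) (\<lambda>x. scaleR (1/2) (d (u x)))
    (\<lambda>x. scaleR (1/2) (d (cadj u x))) (\<lambda>x. scaleR (1/2) (x - w x)))" (is "cproj ?L")
proof -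
  let ?v = "cadj u"
  have cbu: "cbounded u" and uv: "u (?v x) = x" "?v (u x) = x" for x using u by (auto simp: unitary_op_def)
  note cbv = cbounded_cadj[OF cbu]
  note cb = cselfadj_cb[OF w] cselfadj_cb[OF d] cbu cbv
  note lin = cb[THEN cb_add] cb[THEN cb_diff] cb[THEN cb_scaleR]
  have wv: "w (?v x) = ?v (w x)" for x by (metis uv wu)
  have dv: "d (?v x) = ?v (d x)" for x by (metis uv du)
  have cbL: "cbounded ?L"
    by (intro lift_cbounded cbounded_scaleR cbounded_add cbounded_diff cbounded_id cb cbounded_comp[of d])
  show ?thesis unfolding cproj_def
  proof (intro conjI cselfadjI cbL)
    fix x y
    show "cinner (?L x) y = cinner x (?L y)"
      unfolding lift_def
      by (simp add: U_cinner_J J_cinner_U cinner_lin cselfadjD[OF w] cselfadjD[OF d] du[symmetric] dv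
          cadj[OF cbu] cadj'[OF cbu] algebra_simps)
    show "?L \<circ> ?L = ?L"
    proof
      fix x
      define a b where "a = J1 x" and "b = J2 x"
      define p q where "p = scaleR (1/2) (a + w a) + scaleR (1/2) (d (u b))"
        and "q = scaleR (1/2) (d (?v a)) + scaleR (1/2) (b - w b)"
      have dd: "d (d z) = z - w (w z)" for z using sq[of z] by (simp add: algebra_simps)
      have "w p = scaleR (1/2) (w a + w (w a)) + scaleR (1/2) (d (u (w b)))"
        by (simp only: p_def lin wd wu)
      moreover have "d (u q) = scaleR (1/2) (a - w (w a)) + scaleR (1/2) (d (u b) - d (u (w b)))"
        by (simp only: q_def lin du[symmetric] uv dd)
      ultimately have "scaleR (1/2) (p + w p) + scaleR (1/2) (d (u q)) = p"
        unfolding p_def by (simp only: projection_entries(1))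
      moreover have "w q = scaleR (1/2) (d (?v (w a))) + scaleR (1/2) (w b - w (w b))"
        by (simp only: q_def lin wd wv)
      moreover have "d (?v p) = scaleR (1/2) (d (?v a) + d (?v (w a))) + scaleR (1/2) (b - w (w b))"
        by (simp only: p_def lin dv[symmetric] uv dd)
      ultimately have "scaleR (1/2) (p + w p) + scaleR (1/2) (d (u q)) = p"
        "scaleR (1/2) (d (?v p)) + scaleR (1/2) (q - w q) = q"
        unfolding q_def by (simp_all only: projection_entries(2))
      then show "(?L \<circ> ?L) x = ?L x"
        by (simp add: lift_def JU p_def q_def a_def b_def)
    qed
  qed
qed

end

section \<open>Eigenspaces and projections\<close>

lemma csubsp_eigsp:
  assumes T: "cbounded T" shows "csubsp (eigsp T mu)"
  unfolding csubsp_def eigsp_def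
proof (intro conjI ballI allI)
  show "closed {x. T x = scaleR mu x}"
    by (intro closed_Collect_eq continuous_intros bounded_linear.continuous_on[OF cb_bounded_linear[OF T]])
qed (auto simp: cb_lin[OF T] scaleC_scaleR scaleR_add_right)

lemma csubsp_orth_compl: "csubsp (orth_compl S)"
proof -
  have "orth_compl S = (\<Inter>y\<in>S. {x. cinner y x = 0})" by (auto simp: orth_compl_def)
  moreover have "closed {x. cinner y x = 0}" for y :: 'a
    by (intro closed_Collect_eq continuous_intros
        bounded_linear.continuous_on[OF bounded_bilinear.bounded_linear_right[OF bounded_bilinear_cinner]])
  ultimately have "closed (orth_compl S)" by (auto intro!: closed_INT)
  then show ?thesis by (auto simp: csubsp_def orth_compl_def cinner_lin)
qed

lemma eigsp_orth:
  assumes T: "cselfadj T" and "mu \<noteq> nu" "x \<in> eigsp T mu" "y \<in> eigsp T nu"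
  shows "cinner x y = 0"
proof -
  have "of_real mu * cinner x y = of_real nu * cinner x y"
    using cselfadjD[OF T, of x y] assms(3,4) by (simp add: eigsp_def cinner_lin)
  then show ?thesis using assms(2) by simp
qed

lemma cprojD:
  assumes "cproj P"
  shows cproj_sa: "cselfadj P" and cproj_cb: "cbounded P" and cproj_idem: "P (P x) = P x"
  using assms by (auto simp: cproj_def cselfadj_def fun_eq_iff)

lemma cprojI: "cselfadj P \<Longrightarrow> (\<And>x. P (P x) = P x) \<Longrightarrow> cproj P"
  by (auto simp: cproj_def)

lemma cproj_zero: "cproj (\<lambda>x. 0)"
  by (rule cprojI) (auto simp: cselfadj_zero)

lemma cproj_compl: assumes P: "cproj P" shows "cproj (\<lambda>x. x - P x)"
  by (rule cprojI) (auto intro!: cselfadj_diff cselfadj_id cproj_sa[OF P]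
      simp: cb_lin[OF cproj_cb[OF P]] cproj_idem[OF P])

lemma cproj_swap:
  assumes "cproj A" "cproj C" "\<And>x. A (C x) = 0" shows "C (A x) = 0"
  by (rule cinner_extR) (use assms in \<open>simp add: cselfadjD[OF cproj_sa, symmetric]\<close>)

lemma cproj_add:
  assumes A: "cproj A" and C: "cproj C" and o: "\<And>x. A (C x) = 0"
  shows "cproj (\<lambda>x. A x + C x)"
proof (rule cprojI)
  show "cselfadj (\<lambda>x. A x + C x)" by (rule cselfadj_add[OF cproj_sa[OF A] cproj_sa[OF C]])
  show "A (A x + C x) + C (A x + C x) = A x + C x" for x
    by (simp add: cb_lin[OF cproj_cb[OF A]] cb_lin[OF cproj_cb[OF C]] cproj_idem A C o cproj_swap[OF A C o])
qed

lemma cproj_orth_zero: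
  assumes A: "cproj A" and o: "\<And>y. cinner (A y) x = 0"
  shows "A x = 0"
  by (rule cinner_extR) (simp add: cselfadjD[OF cproj_sa[OF A], symmetric] o)

lemma cproj_norm_sq: "cproj P \<Longrightarrow> Re (cinner x (P x)) = (norm (P x))\<^sup>2"
  using Re_cinner_sq[OF cproj_sa, of P x] by (simp add: cproj_idem)

text \<open>From \<open>Q x = - lam P x\<close> the squared norm of \<open>Q x\<close> is both
  \<open>- lam\<close> and \<open>lam\<^sup>2\<close> times that of \<open>P x\<close>. Applied also
  to complements of projections, this settles all nondegenerate eigenspaces.\<close>

lemma combination_kernel:
  assumes P: "cproj P" and Q: "cproj Q" and lam: "lam \<noteq> 0" "lam \<noteq> -1"
    and z: "scaleR lam (P x) + Q x = 0"
  shows "P x = 0 \<and> Q x = 0"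
proof -
  have q: "Q x = scaleR (- lam) (P x)" using z by (simp add: add_eq_0_iff)
  have "(norm (Q x))\<^sup>2 = - lam * (norm (P x))\<^sup>2"
    using cproj_norm_sq[OF Q, of x] cproj_norm_sq[OF P, of x] by (simp add: q cinner_lin)
  moreover have "(norm (Q x))\<^sup>2 = lam\<^sup>2 * (norm (P x))\<^sup>2" by (simp add: q power_mult_distrib)
  ultimately have "(lam * (lam + 1)) * (norm (P x))\<^sup>2 = 0" by (simp add: algebra_simps power2_eq_square)
  then have "P x = 0" using lam by simp
  then show ?thesis by (simp add: q)
qed

text \<open>The projection onto the line of \<open>x\<close>. The quotient normalizes
  \<open>x\<close>, and for \<open>x = 0\<close> the operator is zero.\<close>

definition rank_one :: "'a::chilbert \<Rightarrow> 'a \<Rightarrow> 'a" where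
  "rank_one x y = scaleC (cinner x y / cinner x x) x"

lemma cproj_rank_one: "cproj (rank_one x)"
proof (cases "x = 0")
  case True then have "rank_one x = (\<lambda>y. 0)" by (simp add: rank_one_def fun_eq_iff)
  then show ?thesis by (simp add: cproj_zero)
next
  case False
  then have n: "cinner x x \<noteq> 0" by (simp add: cinner_eq_zero_iff)
  have r: "cnj (cinner x x) = cinner x x" by (metis cinner_commute)
  have c: "cbounded (rank_one x)"
  proof (rule cboundedI[of _ 1])
    fix y
    have "norm (rank_one x y) = cmod (cinner x y) / norm x"
      using False by (simp add: rank_one_def norm_scaleC norm_divide cmod_cinner_self power2_eq_square)
    also have "\<dots> \<le> norm y" using cauchy_schwarz[of x y] False by (simp add: field_simps)
    finally show "norm (rank_one x y) \<le> 1 * norm y" by simp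
  qed (auto simp: rank_one_def cinner_lin add_divide_distrib scaleC_add_left scaleC_scaleC)
  show ?thesis
  proof (rule cprojI[OF cselfadjI[OF c]])
    fix y z
    have "cnj (cinner x y) = cinner y x" by (metis cinner_commute)
    then show "cinner (rank_one x y) z = cinner y (rank_one x z)"
      by (simp add: rank_one_def cinner_lin r)
    show "rank_one x (rank_one x y) = rank_one x y" using n by (simp add: rank_one_def cinner_lin)
  qed
qed

lemma rank_one_self: "rank_one x x = x"
  by (cases "x = 0") (auto simp: rank_one_def cinner_eq_zero_iff scaleC_one)

text \<open>Comparing the eigenvalues of \<open>x\<close>, \<open>y\<close> and
  \<open>x + y\<close>: either all agree, or \<open>y\<close> is a multiple of \<open>x\<close> and
  has the same eigenvalue anyway.\<close>

lemma scalar_on_if_eigenvectors: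
  assumes S: "csubsp S" and W: "cbounded W" and ev: "\<And>x. x \<in> S \<Longrightarrow> \<exists>c. W x = scaleC c x"
  shows "scalar_on W S"
proof (cases "\<exists>x\<in>S. x \<noteq> 0")
  case False
  then show ?thesis by (auto simp: scalar_on_def cb_zero[OF W] intro!: exI[of _ 0])
next
  case True
  then obtain x where x: "x \<in> S" "x \<noteq> 0" by blast
  obtain c where c: "W x = scaleC c x" using ev x by blast
  have inj: "p = q" if "scaleC p x = scaleC q x" for p q
  proof -
    have "norm (scaleC (p - q) x) = 0" using that by (simp add: scaleC_diff_left)
    then show ?thesis using x by (simp add: norm_scaleC)
  qed
  have "W y = scaleC c y" if y: "y \<in> S" for y
  proof -
    obtain d where d: "W y = scaleC d y" using ev y by blast
    have "x + y \<in> S" using S x y by (auto simp: csubsp_def)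
    then obtain e where "W (x + y) = scaleC e (x + y)" using ev by blast
    then have e: "scaleC (d - e) y = scaleC (e - c) x"
      by (simp add: cb_lin[OF W] c d scaleC_add_right scaleC_diff_left algebra_simps)
    show ?thesis
    proof (cases "d = e")
      case True
      then have "e = c" using inj[of "e - c" 0] e by simp
      then show ?thesis using d True by simp
    next
      case False
      then have "y = scaleC (1 / (d - e)) (scaleC (d - e) y)" by (simp add: scaleC_scaleC scaleC_one)
      also have "\<dots> = scaleC ((e - c) / (d - e)) x" unfolding e by (simp add: scaleC_scaleC)
      finally have "W y = scaleC ((e - c) / (d - e)) (W x)" by (metis cb_scaleC[OF W])
      also have "\<dots> = scaleC c (scaleC ((e - c) / (d - e)) x)" by (simp add: c scaleC_scaleC mult.commute)
      finally show ?thesis using \<open>y = _\<close> \<open>scaleC (1 / (d - e)) _ = _\<close> by simp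
    qed
  qed
  then show ?thesis by (auto simp: scalar_on_def)
qed

section \<open>Projection pairs with a given combination\<close>

locale generic_part =
  fixes T :: "'a::chilbert \<Rightarrow> 'a" and lam :: real
    and B :: "'k::chilbert \<Rightarrow> 'k" and U :: "'k \<times> 'k \<Rightarrow> 'a"
  assumes lam: "lam \<noteq> 0" "lam \<noteq> -1"
    and T_sa: "cselfadj T"
    and U_unitary: "pair_unitary U (generic_space T lam)"
    and B_pos: "cpositive B"
    and B_lower: "op_less (\<lambda>x. scaleR (\<bar>1 - \<bar>lam\<bar>\<bar> / 2) x) B"
    and B_upper: "op_less B (\<lambda>x. scaleR ((1 + \<bar>lam\<bar>) / 2) x)"
    and T0: "\<And>x y. T (U (x, y)) - scaleR ((1 + lam) / 2) (U (x, y)) = U (B x, - B y)"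

sublocale generic_part \<subseteq> pair_decomposition U "generic_space T lam"
  using U_unitary csubsp_orth_compl by unfold_locales (auto simp: generic_space_def)

context generic_part
begin

text \<open>A set, so that coinciding eigenvalues count once in sums over it. With \<open>0\<close>
  and \<open>-1\<close> excluded for \<open>lam\<close>, the only possible coincidence is
  \<open>lam = 1\<close>.\<close>

definition eigs :: "real set" where "eigs = {0, 1, lam, 1 + lam}"
text \<open>For \<open>\<lambda> = 1\<close> the eigenvalues \<open>1\<close> and \<open>\<lambda>\<close> coincide, and on the common eigenspace
  the pairs are \<open>(P, I - P)\<close> with \<open>P\<close> arbitrary.\<close>

definition degen :: "real set" where "degen = (if lam = 1 then {1} else {})"

abbreviation "N \<equiv> eigsp T"
abbreviation "H0 \<equiv> generic_space T lam"

lemmas T_cb = cselfadj_cb[OF T_sa]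
lemmas T_lin = cb_lin[OF T_cb]
lemmas N_csubsp = csubsp_eigsp[OF T_cb]
lemmas E_cproj = cproj_projon[OF N_csubsp]
lemma Bp: "pos_op B" by (rule cpositive_pos_op[OF B_pos])
lemmas B_cb = pos_op_cb[OF Bp]
lemmas B_lin = cb_lin[OF B_cb]

lemma zero_N: "0 \<in> N mu" by (simp add: eigsp_def T_lin)

text \<open>If \<open>\<bar>lam\<bar> = 1\<close>, the strict lower bound reads
  \<open>0 < B\<close>, which includes injectivity; otherwise \<open>B\<close> is bounded below by a
  positive scalar.\<close>

lemma B_inj: assumes "B x = 0" shows "x = 0"
proof (cases "\<bar>lam\<bar> = 1")
  case True
  then have "inj B" using B_lower by (simp add: op_less_def)
  then show ?thesis using assms B_lin(6) by (metis injD)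
next
  case False
  define dl where "dl = \<bar>1 - \<bar>lam\<bar>\<bar> / 2"
  have dl: "dl > 0" using False by (simp add: dl_def)
  have "pos_op (\<lambda>x. B x - scaleR dl x)" using B_lower by (simp add: op_less_def dl_def cpositive_pos_op)
  from pos_opD[OF this, of x] have "dl * (norm x)\<^sup>2 \<le> 0" using assms by (simp add: cinner_lin cinner_self)
  then show ?thesis using dl by (simp add: mult_le_0_iff)
qed

lemma generic_iff: "x \<in> H0 \<longleftrightarrow> (\<forall>mu\<in>eigs. \<forall>y\<in>N mu. cinner y x = 0)"
proof
  assume x: "x \<in> H0"
  have *: "cinner (a + b + c + d) x = 0" if "a \<in> N 0" "b \<in> N 1" "c \<in> N lam" "d \<in> N (1 + lam)" for a b c d
    using x that unfolding generic_space_def orth_compl_def by blast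
  show "\<forall>mu\<in>eigs. \<forall>y\<in>N mu. cinner y x = 0"
    unfolding eigs_def using *[of _ 0 0 0] *[of 0 _ 0 0] *[of 0 0 _ 0] *[of 0 0 0 _] zero_N by auto
next
  assume "\<forall>mu\<in>eigs. \<forall>y\<in>N mu. cinner y x = 0"
  then show "x \<in> H0" by (auto simp: generic_space_def orth_compl_def cinner_lin eigs_def)
qed

lemma generic_orth: "x \<in> H0 \<Longrightarrow> mu \<in> eigs \<Longrightarrow> y \<in> N mu \<Longrightarrow> cinner y x = 0"
  using generic_iff by blast

lemma generic_orth': "x \<in> H0 \<Longrightarrow> mu \<in> eigs \<Longrightarrow> y \<in> N mu \<Longrightarrow> cinner x y = 0"
  using generic_orth cinner_sym_zero by blast

text \<open>Distinct eigenspaces are orthogonal, so subtracting the projections onto all of them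
  leaves a vector orthogonal to each, that is, one in \<open>H0\<close>.\<close>

lemma decomposition: "x = (\<Sum>mu\<in>eigs. projon (N mu) x) + projon H0 x"
proof -
  define r where "r = x - (\<Sum>mu\<in>eigs. projon (N mu) x)"
  have fin: "finite eigs" by (simp add: eigs_def)
  have cs: "cinner y (sum f A) = (\<Sum>a\<in>A. cinner y (f a))" for y :: 'a and f :: "real \<Rightarrow> 'a" and A
    by (induction A rule: infinite_finite_induct) (auto simp: cinner_lin)
  have "r \<in> H0" unfolding generic_iff
  proof (intro ballI)
    fix nu y assume nu: "nu \<in> eigs" and y: "y \<in> N nu"
    have "cinner y (\<Sum>mu\<in>eigs. projon (N mu) x) = (\<Sum>mu\<in>eigs. if mu = nu then cinner y x else 0)"
      unfolding cs
    proof (rule sum.cong[OF refl])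
      fix mu assume "mu \<in> eigs"
      show "cinner y (projon (N mu) x) = (if mu = nu then cinner y x else 0)"
        using projon_orth[OF N_csubsp y, of x] eigsp_orth[OF T_sa _ y projon_in[OF N_csubsp], of mu x]
        by (auto simp: cinner_diff_right)
    qed
    also have "\<dots> = cinner y x" using fin nu by simp
    finally show "cinner y r = 0" by (simp add: r_def cinner_lin)
  qed
  then have "projon H0 x = r"
  proof (rule projon_unique[OF S])
    fix y assume y: "y \<in> H0"
    have "cinner y (\<Sum>mu\<in>eigs. projon (N mu) x) = 0"
      unfolding cs using generic_orth'[OF y] projon_in[OF N_csubsp] by (intro sum.neutral) blast
    then show "cinner y (x - r) = 0" by (simp add: r_def)
  qed
  then show ?thesis by (simp add: r_def)
qed

lemma eq_blocks:
  assumes f: "cbounded f" and g: "cbounded g"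
    and N: "\<And>mu x. mu \<in> eigs \<Longrightarrow> x \<in> N mu \<Longrightarrow> f x = g x"
    and H0: "\<And>u v. f (U (u, v)) = g (U (u, v))"
  shows "f x = g x"
proof -
  have s: "h x = (\<Sum>mu\<in>eigs. h (projon (N mu) x)) + h (projon H0 x)" if "cbounded h" for h
  proof -
    have "h x = h ((\<Sum>mu\<in>eigs. projon (N mu) x) + projon H0 x)" using decomposition[of x] by simp
    then show ?thesis
      by (simp add: cb_add[OF that] linear_sum[OF bounded_linear.linear[OF cb_bounded_linear[OF that]]])
  qed
  have "f (projon H0 x) = g (projon H0 x)" using H0 by (metis UJ)
  moreover have "(\<Sum>mu\<in>eigs. f (projon (N mu) x)) = (\<Sum>mu\<in>eigs. g (projon (N mu) x))"
    using N projon_in[OF N_csubsp] by (intro sum.cong) auto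
  ultimately show ?thesis using s[OF f] s[OF g] by simp
qed

lemma T_U: "T (U (u, v)) = U (B u + scaleR ((1 + lam) / 2) u, scaleR ((1 + lam) / 2) v - B v)"
proof -
  have "T (U (u, v)) = U (B u, - B v) + scaleR ((1 + lam) / 2) (U (u, v))"
    using T0[of u v] by (metis diff_add_cancel)
  then show ?thesis by (simp add: U_scaleR U_add)
qed

text \<open>Invariance of subspaces under \<open>Y\<close> gives invariance of their orthogonal
  complement under its adjoint \<open>X\<close>. The two operators are kept apart because the lemma
  serves both a projection \<open>Q\<close> and a general member of the commutant.\<close>

lemma generic_invariant:
  assumes adj: "\<And>x y. cinner (Y x) y = cinner x (X y)" and inv: "\<And>mu y. mu \<in> eigs \<Longrightarrow> y \<in> N mu \<Longrightarrow> Y y \<in> N mu"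
    and x: "x \<in> H0"
  shows "X x \<in> H0"
  unfolding generic_iff using generic_orth[OF x _ inv] by (metis adj)

lemma N_scaleR: "x \<in> N mu \<Longrightarrow> scaleR r x \<in> N mu"
  by (rule csubsp_scaleR[OF N_csubsp])

lemma N_scaleC: "x \<in> N mu \<Longrightarrow> scaleC r x \<in> N mu"
  using N_csubsp by (auto simp: csubsp_def)

section \<open>The two block algebras and the operators of the pairs\<close>

definition commutant_blocks :: "('a \<Rightarrow> 'a) set" where
  "commutant_blocks = {A. cbounded A \<and> (\<forall>mu\<in>eigs - degen. invariant_on A (N mu)) \<and> (\<forall>mu\<in>degen. scalar_on A (N mu))
     \<and> diag2_on A U (commutant (commutant {B}))}"

text \<open>Scalar and arbitrary blocks are exchanged relative to \<open>commutant_blocks\<close>.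
  Invariance of \<open>H0\<close> is contained in the last condition, as the range of
  \<open>U\<close> is \<open>H0\<close>.\<close>

definition algebra_blocks :: "('a \<Rightarrow> 'a) set" where
  "algebra_blocks = {A. cbounded A \<and> (\<forall>mu\<in>eigs - degen. scalar_on A (N mu)) \<and> (\<forall>mu\<in>degen. invariant_on A (N mu))
     \<and> M2_on A U (commutant {B})}"

definition pair_operators :: "('a \<Rightarrow> 'a) set" where
  "pair_operators = fst ` T_pairs T lam \<union> snd ` T_pairs T lam"

lemma pair_operators_selfadj: "X \<in> pair_operators \<Longrightarrow> cselfadj X"
  by (auto simp: pair_operators_def T_pairs_def cproj_sa)

lemma pair_in_pair_operators: "(P, Q) \<in> T_pairs T lam \<Longrightarrow> P \<in> pair_operators \<and> Q \<in> pair_operators"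
  unfolding pair_operators_def by force

lemma commutant_B_iff: "X \<in> commutant {B} \<longleftrightarrow> cbounded X \<and> (\<forall>x. X (B x) = B (X x))"
  by (auto simp: commutant_def fun_eq_iff)

lemma B_mem: "B \<in> commutant {B}" by (simp add: commutant_B_iff B_cb)

lemma double_commutant_B: "Y \<in> commutant (commutant {B}) \<Longrightarrow> X \<in> commutant {B} \<Longrightarrow> Y (X x) = X (Y x)"
  by (rule commutantD)

lemma mem_double_commutant_B:
  "cbounded Y \<Longrightarrow> (\<And>X x. cbounded X \<Longrightarrow> (\<And>x. X (B x) = B (X x)) \<Longrightarrow> Y (X x) = X (Y x))
    \<Longrightarrow> Y \<in> commutant (commutant {B})"
  by (rule commutantI) (auto simp: commutant_B_iff)

lemma pair_scalar:
  assumes PQ: "(P, Q) \<in> T_pairs T lam" and mu: "mu \<in> eigs - degen"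
  obtains p q where "\<And>x. x \<in> N mu \<Longrightarrow> P x = scaleR p x \<and> Q x = scaleR q x"
proof -
  have P: "cproj P" and Q: "cproj Q" and T: "\<And>x. T x = scaleR lam (P x) + Q x"
    using PQ by (auto simp: T_pairs_def)
  note k = combination_kernel
  consider "mu = 0" | "mu = 1" "lam \<noteq> 1" | "mu = lam" "lam \<noteq> 1" | "mu = 1 + lam"
    using mu by (auto simp: eigs_def degen_def split: if_splits)
  then show ?thesis
  proof cases
    case 1
    show ?thesis
    proof (rule that[of 0 0])
      fix x assume "x \<in> N mu"
      then show "P x = scaleR 0 x \<and> Q x = scaleR 0 x"
        using k[OF P Q lam, of x] T[of x] 1 by (simp add: eigsp_def)
    qed
  next
    case 2
    show ?thesis
    proof (rule that[of 0 1])
      fix x assume "x \<in> N mu"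
      then have "x = scaleR lam (P x) + Q x" using T[of x] 2 by (simp add: eigsp_def)
      \<comment> \<open>The coefficient is now \<open>- lam\<close>, which differs from
        \<open>-1\<close> because \<open>lam \<noteq> 1\<close>; this is where the degenerate
        eigenvalue drops out.\<close>
      then have "scaleR (- lam) (P x) + (x - Q x) = 0" by (simp add: algebra_simps)
      then show "P x = scaleR 0 x \<and> Q x = scaleR 1 x"
        using k[OF P cproj_compl[OF Q], of "- lam" x] lam 2 by simp
    qed
  next
    case 3
    show ?thesis
    proof (rule that[of 1 0])
      fix x assume "x \<in> N mu"
      then have "scaleR lam x = scaleR lam (P x) + Q x" using T[of x] 3 by (simp add: eigsp_def)
      then have "scaleR (- lam) (x - P x) + Q x = 0" by (simp add: algebra_simps)
      then show "P x = scaleR 1 x \<and> Q x = scaleR 0 x"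
        using k[OF cproj_compl[OF P] Q, of "- lam" x] lam 3 by simp
    qed
  next
    case 4
    show ?thesis
    proof (rule that[of 1 1])
      fix x assume "x \<in> N mu"
      then show "P x = scaleR 1 x \<and> Q x = scaleR 1 x"
        using k[OF cproj_compl[OF P] cproj_compl[OF Q] lam, of x] T[of x] 4
        by (simp add: eigsp_def scaleR_diff_right scaleR_add_left algebra_simps)
    qed
  qed
qed

lemma pair_invariant:
  assumes PQ: "(P, Q) \<in> T_pairs T lam" and mu: "mu \<in> eigs" and x: "x \<in> N mu"
  shows "Q x \<in> N mu"
proof (cases "mu \<in> degen")
  case True
  then have l: "lam = 1" "mu = 1" by (auto simp: degen_def split: if_splits)
  have P: "cproj P" and Q: "cproj Q" and T: "\<And>x. T x = P x + Q x"
    using PQ l by (auto simp: T_pairs_def)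
  \<comment> \<open>On the common eigenspace idempotence of \<open>P\<close> gives
    \<open>P Q x = 0\<close>, hence \<open>T (Q x) = Q x\<close>.\<close>
  have "P x = x - Q x" using x T[of x] l by (simp add: eigsp_def algebra_simps)
  then have "P (x - Q x) = x - Q x" using cproj_idem[OF P, of x] by simp
  then have "P (Q x) = 0" using \<open>P x = _\<close> by (simp add: cb_lin[OF cproj_cb[OF P]])
  then show ?thesis using l T[of "Q x"] cproj_idem[OF Q] by (simp add: eigsp_def)
next
  case False
  then show ?thesis using pair_scalar[OF PQ, of mu] mu x N_scaleR by (metis DiffI)
qed

lemma pair_entries:
  assumes PQ: "(P, Q) \<in> T_pairs T lam"
  obtains Q11 Q12 Q21 Q22 where "Q11 \<in> commutant {B}" "Q12 \<in> commutant {B}" "Q21 \<in> commutant {B}" "Q22 \<in> commutant {B}"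
    "\<And>u v. Q (U (u, v)) = U (Q11 u + Q12 v, Q21 u + Q22 v)"
proof -
  have P: "cproj P" and Q: "cproj Q" and T: "\<And>x. T x = scaleR lam (P x) + Q x"
    using PQ by (auto simp: T_pairs_def)
  note Qlin = cb_lin[OF cproj_cb[OF Q]]
  have TP: "scaleR lam (P x) = T x - Q x" for x by (simp add: T)
  \<comment> \<open>Idempotence of \<open>P\<close> written as
    \<open>(T - Q)\<^sup>2 = lam (T - Q)\<close>; in terms of \<open>S\<close> and \<open>V\<close>
    it is the anticommutator relation.\<close>
  have E: "T (Q x) + Q (T x) = T (T x) - scaleR lam (T x) + scaleR (1 + lam) (Q x)" for x
  proof -
    have "T (T x - Q x) = scaleR lam (T (P x))" by (simp add: TP[symmetric] T_lin)
    also have "\<dots> = scaleR lam (scaleR lam (P x) + Q (P x))" by (simp only: T cproj_idem[OF P])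
    also have "\<dots> = scaleR lam (T x - Q x) + Q (T x - Q x)"
      by (simp only: scaleR_add_right TP[symmetric] cb_scaleR[OF cproj_cb[OF Q]])
    finally show ?thesis by (simp add: T_lin Qlin cproj_idem[OF Q] algebra_simps)
  qed
  have "Q x \<in> H0" if "x \<in> H0" for x
    by (rule generic_invariant[OF cselfadjD[OF cproj_sa[OF Q]] pair_invariant[OF PQ] that])
  from entries[OF cproj_cb[OF Q] this]
  obtain Q11 Q12 Q21 Q22 where cb: "cbounded Q11" "cbounded Q12" "cbounded Q21" "cbounded Q22"
    and QU: "\<And>u v. Q (U (u, v)) = U (Q11 u + Q12 v, Q21 u + Q22 v)" by blast
  note lin = cb[THEN cb_add] cb[THEN cb_diff] cb[THEN cb_scaleR] cb[THEN cb_zero] cb[THEN cb_minus]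
  define ka where "ka = (1 - lam\<^sup>2) / 4"
  define s where "s = (1 + lam) / 2"
  have s1: "1 + lam = s + s" and s2: "ka = s * s - lam * s"
    by (simp_all add: s_def ka_def field_simps power2_eq_square)
  have TU: "T (U (u, v)) = U (B u + scaleR s u, scaleR s v - B v)" for u v by (simp add: T_U s_def)
  have l: "lam = s + s - 1" using s1 by simp
  have d: "scaleR (s * 2) z = scaleR s z + scaleR s z" "scaleR (s * (s * 2)) z = scaleR (s * s) z + scaleR (s * s) z"
    for z :: 'k by (simp_all add: scaleR_add_left[symmetric])
  have 1: "B (Q11 u) + Q11 (B u) = B (B u) + B u + scaleR ka u" "B (Q21 u) = Q21 (B u)" for u
    using E[of "U (u, 0)"] unfolding s2 s1 l
    by (simp_all add: QU TU U_add U_diff U_scaleR U_inj lin B_lin d algebra_simps)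
  have 2: "B (Q22 v) + Q22 (B v) = B v - B (B v) - scaleR ka v" "B (Q12 v) = Q12 (B v)" for v
    using E[of "U (0, v)"] unfolding s2 s1 l
    by (simp_all add: QU TU U_add U_diff U_scaleR U_inj lin B_lin d algebra_simps)
  \<comment> \<open>The upper diagonal relation at \<open>B x\<close> and its image under
    \<open>B\<close> have the same right side and share the term \<open>B Q11 B\<close>; what
    remains is commutation with \<open>B\<^sup>2\<close>.\<close>
  have "B (Q11 (B x)) + Q11 (B (B x)) = B (Q11 (B x)) + B (B (Q11 x))" for x
    using 1(1)[of "B x"] arg_cong[OF 1(1)[of x], of B] by (simp add: B_lin ac_simps)
  then have "Q11 (B (B x)) = B (B (Q11 x))" for x by simp
  then have "Q11 (B x) = B (Q11 x)" for x by (rule commute_sq_imp[OF Bp cb(1)])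
  moreover have "B (Q22 (B x)) + Q22 (B (B x)) = B (Q22 (B x)) + B (B (Q22 x))" for x
    using 2(1)[of "B x"] arg_cong[OF 2(1)[of x], of B] by (simp add: B_lin ac_simps)
  then have "Q22 (B (B x)) = B (B (Q22 x))" for x by simp
  then have "Q22 (B x) = B (Q22 x)" for x by (rule commute_sq_imp[OF Bp cb(4)])
  ultimately show ?thesis
    using that[of Q11 Q12 Q21 Q22] cb QU 1(2) 2(2) by (simp add: commutant_B_iff)
qed

lemma degen_cases: "mu \<in> degen \<Longrightarrow> lam = 1 \<and> mu = 1"
  by (auto simp: degen_def split: if_splits)

lemma degen_subset: "degen \<subseteq> eigs"
  by (auto simp: degen_def eigs_def)

lemma commutant_blocks_invariant: "A \<in> commutant_blocks \<Longrightarrow> mu \<in> eigs \<Longrightarrow> x \<in> N mu \<Longrightarrow> A x \<in> N mu"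
proof (cases "mu \<in> degen")
  case True
  moreover assume "A \<in> commutant_blocks" "x \<in> N mu"
  ultimately obtain c where "A x = scaleC c x" by (auto simp: commutant_blocks_def scalar_on_def)
  then show ?thesis using \<open>x \<in> N mu\<close> by (simp add: N_scaleC)
qed (auto simp: commutant_blocks_def invariant_on_def)

text \<open>Commutation is checked block by block for \<open>T\<close> and \<open>Q\<close>; that
  with \<open>P\<close> follows from \<open>lam P = T - Q\<close>. On every eigenspace one of
  \<open>A\<close> and \<open>Q\<close> is a scalar and the other leaves the space
  invariant.\<close>

lemma commutant_blocks_commute: assumes A: "A \<in> commutant_blocks" shows "A \<in> commutant pair_operators"
proof -
  have cb: "cbounded A" using A by (simp add: commutant_blocks_def)
  note lin = cb_lin[OF cb]
  obtain Y where Y: "Y \<in> commutant (commutant {B})" and AU: "\<And>u v. A (U (u, v)) = U (Y u, Y v)"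
    using A by (auto simp: commutant_blocks_def diag2_on_def)
  note Ylin = cb_lin[OF commutant_cb[OF Y]]
  have AT: "A (T x) = T (A x)" for x
  proof (rule eq_blocks[where f = "\<lambda>x. A (T x)" and g = "\<lambda>x. T (A x)"])
    show "cbounded (\<lambda>x. A (T x))" "cbounded (\<lambda>x. T (A x))" by (rule cbounded_comp[OF cb T_cb] cbounded_comp[OF T_cb cb])+
    show "A (T x) = T (A x)" if "mu \<in> eigs" "x \<in> N mu" for mu x
      using commutant_blocks_invariant[OF A that] that by (simp add: eigsp_def lin)
    show "A (T (U (u, v))) = T (A (U (u, v)))" for u v
      by (simp add: T_U AU Ylin double_commutant_B[OF Y B_mem])
  qed
  have AQ: "A (Q x) = Q (A x)" if PQ: "(P, Q) \<in> T_pairs T lam" for P Q x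
  proof (rule eq_blocks[where f = "\<lambda>x. A (Q x)" and g = "\<lambda>x. Q (A x)"])
    have Q: "cproj Q" using PQ by (simp add: T_pairs_def)
    show "cbounded (\<lambda>x. A (Q x))" "cbounded (\<lambda>x. Q (A x))"
      by (rule cbounded_comp[OF cb cproj_cb[OF Q]] cbounded_comp[OF cproj_cb[OF Q] cb])+
    show "A (Q x) = Q (A x)" if mu: "mu \<in> eigs" and x: "x \<in> N mu" for mu x
    proof (cases "mu \<in> degen")
      case True
      then obtain c where "\<And>x. x \<in> N mu \<Longrightarrow> A x = scaleC c x"
        using A by (auto simp: commutant_blocks_def scalar_on_def)
      then show ?thesis using x pair_invariant[OF PQ mu x] by (simp add: cb_lin[OF cproj_cb[OF Q]])
    next
      case False
      then obtain p q where "\<And>x. x \<in> N mu \<Longrightarrow> P x = scaleR p x \<and> Q x = scaleR q x"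
        using pair_scalar[OF PQ, of mu] mu by blast
      then show ?thesis using x commutant_blocks_invariant[OF A mu x] by (simp add: lin)
    qed
    show "A (Q (U (u, v))) = Q (A (U (u, v)))" for u v
    proof -
      obtain Q11 Q12 Q21 Q22
        where "Q11 \<in> commutant {B}" "Q12 \<in> commutant {B}" "Q21 \<in> commutant {B}" "Q22 \<in> commutant {B}"
          "\<And>u v. Q (U (u, v)) = U (Q11 u + Q12 v, Q21 u + Q22 v)"
        using pair_entries[OF PQ] by metis
      then show ?thesis by (simp add: AU Ylin double_commutant_B[OF Y])
    qed
  qed
  show ?thesis
  proof (rule commutantI[OF cb])
    fix X x assume "X \<in> pair_operators"
    then obtain P Q where PQ: "(P, Q) \<in> T_pairs T lam" and X: "X = P \<or> X = Q" by (force simp: pair_operators_def)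
    have T: "T x = scaleR lam (P x) + Q x" for x using PQ by (simp add: T_pairs_def)
    have TP: "scaleR lam (P x) = T x - Q x" for x by (simp add: T)
    have "scaleR lam (A (P x)) = scaleR lam (P (A x))"
      by (simp only: cb_scaleR[OF cb, symmetric] TP) (simp add: lin AT AQ[OF PQ])
    then have "A (P x) = P (A x)" using lam by simp
    then show "A (X x) = X (A x)" using X AQ[OF PQ] by auto
  qed
qed

section \<open>Construction of projection pairs\<close>

lemma T_decomposition:
  assumes x: "x = x0 + x1 + xl + xp + U (u, v)"
    and N: "x0 \<in> N 0" "x1 \<in> N 1" "xl \<in> N lam" "xp \<in> N (1 + lam)"
  shows "T x = x1 + scaleR lam xl + scaleR (1 + lam) xp
    + U (B u + scaleR ((1 + lam) / 2) u, scaleR ((1 + lam) / 2) v - B v)"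
  using N by (simp add: x T_lin T_U eigsp_def)

text \<open>\<open>F\<close> and \<open>F'\<close> are the parts of \<open>Q\<close> and \<open>P\<close> on \<open>N(T - I) + N(T - \<lambda>I)\<close>.\<close>

definition admissible :: "('a \<Rightarrow> 'a) \<Rightarrow> ('a \<Rightarrow> 'a) \<Rightarrow> bool" where
  "admissible F F' \<longleftrightarrow> cproj F \<and> cproj F' \<and> (\<forall>x. F x \<in> N 1) \<and> (\<forall>x. F' x \<in> N lam) \<and> (\<forall>x. F (F' x) = 0)
    \<and> (\<forall>x. x = projon (N 0) x + F x + F' x + projon (N (1 + lam)) x + projon H0 x)"

lemma pairs_exist:
  obtains a c where "\<And>X x. X \<in> commutant {B} \<Longrightarrow> X (c x) = c (X x)" "\<And>x. c x = 0 \<Longrightarrow> x = 0"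
    "cbounded c" "cbounded a"
    "\<And>F F' u. admissible F F' \<Longrightarrow> u \<in> commutant {B} \<Longrightarrow> unitary_op u \<Longrightarrow>
      \<exists>P. (P, \<lambda>x. (F x + projon (N (1 + lam)) x) + lift (\<lambda>x. scaleR (1/2) (x + a x)) (\<lambda>x. scaleR (1/2) (c (u x)))
        (\<lambda>x. scaleR (1/2) (c (cadj u x))) (\<lambda>x. scaleR (1/2) (x - a x)) x) \<in> T_pairs T lam"
proof -
  define ka where "ka = (1 - lam\<^sup>2) / 4"
  obtain a where sa: "cselfadj a" and Ba: "\<And>x. B (a x) = B (B x) + scaleR ka x"
    and coma: "\<And>X x. cbounded X \<Longrightarrow> (\<And>x. X (B x) = B (X x)) \<Longrightarrow> X (a x) = a (X x)"
    and apos: "pos_op (\<lambda>x. x - a (a x))" and ainj: "\<And>x. a (a x) = x \<Longrightarrow> x = 0"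
    using symmetry_diagonal[OF lam(2) B_pos B_lower B_upper] unfolding ka_def by blast
  obtain c where c: "pos_op c" and cc: "\<And>x. c (c x) = x - a (a x)"
    and comc: "\<And>X x. cbounded X \<Longrightarrow> (\<And>x. X (x - a (a x)) = X x - a (a (X x))) \<Longrightarrow> X (c x) = c (X x)"
    using sqrt_pos[OF apos] by blast
  note a_cb = cselfadj_cb[OF sa] and c_cb = pos_op_cb[OF c]
  note alin = cb_lin[OF a_cb] and clin = cb_lin[OF c_cb]
  have aB: "a (B x) = B (a x)" for x by (rule coma[OF B_cb, symmetric]) simp
  \<comment> \<open>What commutes with \<open>B\<close> commutes with \<open>a\<close>, hence with
    \<open>1 - a\<^sup>2\<close> and with its root \<open>c\<close>.\<close>
  have comc': "X (c x) = c (X x)" if "X \<in> commutant {B}" for X x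
    using that coma[of X] by (intro comc) (auto simp: commutant_B_iff cb_lin)
  have a_mem: "a \<in> commutant {B}" by (simp add: commutant_B_iff a_cb aB)
  have ac: "a (c x) = c (a x)" for x by (rule comc'[OF a_mem])
  have Bc: "B (c x) = c (B x)" for x by (rule comc'[OF B_mem])
  have cinj: "x = 0" if "c x = 0" for x
    using cc[of x] that ainj[of x] by (simp add: clin)
  \<comment> \<open>\<open>w\<close> and \<open>d\<close> are the entries of the symmetry
    \<open>2 P - I = (2 S - V) / lam\<close> on \<open>H0\<close>, with \<open>d\<close> next to the
    phase \<open>u\<close>.\<close>
  define w where "w x = scaleR (1 / lam) (scaleR 2 (B x) - a x)" for x
  define d where "d x = scaleR (- 1 / lam) (c x)" for x
  have saw: "cselfadj w" unfolding w_def by (intro cselfadj_scaleR cselfadj_diff sa pos_op_sa[OF Bp])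
  have sad: "cselfadj d" unfolding d_def by (intro cselfadj_scaleR pos_op_sa[OF c])
  \<comment> \<open>\<open>4 B\<^sup>2 - 4 B a = - 4 ka\<close> and
    \<open>a\<^sup>2 + c\<^sup>2 = 1\<close>, so \<open>w\<^sup>2 + d\<^sup>2\<close> equals
    \<open>(1 - 4 ka) / lam\<^sup>2\<close>, which is \<open>1\<close>.\<close>
  have k: "(1 / lam * (1 / lam)) * (1 - 4 * ka) = 1"
    using lam by (simp add: ka_def field_simps power2_eq_square)
  have wd: "w (w x) + d (d x) = x" for x
  proof -
    have "w (w x) = scaleR (1 / lam * (1 / lam)) (scaleR 4 (B (B x)) - scaleR 4 (B (a x)) + a (a x))"
      by (simp add: w_def B_lin alin aB algebra_simps)
        (simp add: scaleR_add_left[symmetric])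
    moreover have "d (d x) = scaleR (1 / lam * (1 / lam)) (x - a (a x))"
      by (simp add: d_def clin cc)
    ultimately have "w (w x) + d (d x) = scaleR (1 / lam * (1 / lam)) (x - scaleR (4 * ka) x)"
      by (simp add: Ba algebra_simps)
    also have "x - scaleR (4 * ka) x = scaleR (1 - 4 * ka) x" by (simp add: scaleR_diff_left)
    finally show ?thesis by (simp only: scaleR_scaleR k scaleR_one)
  qed
  have pair: "\<exists>P. (P, \<lambda>x. (F x + projon (N (1 + lam)) x) + lift (\<lambda>x. scaleR (1/2) (x + a x)) (\<lambda>x. scaleR (1/2) (c (u x)))
        (\<lambda>x. scaleR (1/2) (c (cadj u x))) (\<lambda>x. scaleR (1/2) (x - a x)) x) \<in> T_pairs T lam"
    if adm: "admissible F F'" and u: "u \<in> commutant {B}" "unitary_op u" for F F' u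
  proof -
    have F: "cproj F" "\<And>x. F x \<in> N 1" and F': "cproj F'" "\<And>x. F' x \<in> N lam" and FF': "\<And>x. F (F' x) = 0"
      and dec: "\<And>x. x = projon (N 0) x + F x + F' x + projon (N (1 + lam)) x + projon H0 x"
      using adm by (auto simp: admissible_def)
    let ?Ep = "projon (N (1 + lam))"
    let ?LQ = "lift (\<lambda>x. scaleR (1/2) (x + a x)) (\<lambda>x. scaleR (1/2) (c (u x)))
        (\<lambda>x. scaleR (1/2) (c (cadj u x))) (\<lambda>x. scaleR (1/2) (x - a x))"
    let ?LP = "lift (\<lambda>x. scaleR (1/2) (x + w x)) (\<lambda>x. scaleR (1/2) (d (u x)))
        (\<lambda>x. scaleR (1/2) (d (cadj u x))) (\<lambda>x. scaleR (1/2) (x - w x))"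
    have ua: "a (u x) = u (a x)" for x using coma[of u x] u by (simp add: commutant_B_iff)
    have uB: "u (B x) = B (u x)" for x using u by (simp add: commutant_B_iff)
    have uc: "c (u x) = u (c x)" for x using comc'[OF u(1)] by simp
    have u_cb: "cbounded u" using u by (simp add: commutant_B_iff)
    have LQ: "cproj ?LQ"
      by (rule lift_cproj[OF sa pos_op_sa[OF c] u(2) ac ua uc]) (simp add: cc)
    have LP: "cproj ?LP"
    proof (rule lift_cproj[OF saw sad u(2)])
      show "w (d x) = d (w x)" for x by (simp add: w_def d_def clin B_lin alin ac Bc scaleR_diff_right)
      show "w (u x) = u (w x)" for x by (simp add: w_def cb_lin[OF u_cb] ua uB)
      show "d (u x) = u (d x)" for x by (simp add: d_def cb_lin[OF u_cb] uc)
      show "w (w x) + d (d x) = x" for x by (rule wd)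
    qed
    have orth: "A x = 0" if "cproj A" "mu \<in> eigs" "nu \<in> eigs" "mu \<noteq> nu" "\<And>x. A x \<in> N mu" "x \<in> N nu" for A mu nu x
      using cproj_orth_zero[OF that(1)] eigsp_orth[OF T_sa that(4) that(5) that(6)] by blast
    have orthH: "A x = 0" if "cproj A" "mu \<in> eigs" "\<And>x. A x \<in> N mu" "x \<in> H0" for A mu x
      using cproj_orth_zero[OF that(1)] generic_orth[OF that(4) that(2) that(3)] by blast
    have e: "1 \<in> eigs" "lam \<in> eigs" "1 + lam \<in> eigs" by (auto simp: eigs_def)
    have Q: "cproj (\<lambda>x. (F x + ?Ep x) + ?LQ x)"
    proof (intro cproj_add F LQ E_cproj)
      show "F (?Ep x) = 0" for x
        by (rule orth[OF F(1) e(1) e(3) _ F(2) projon_in[OF N_csubsp]]) (use lam in simp)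
      show "F (?LQ x) + ?Ep (?LQ x) = 0" for x
        using orthH[OF F(1) e(1) F(2) lift_in] orthH[OF E_cproj e(3) projon_in[OF N_csubsp] lift_in] by simp
    qed
    have P: "cproj (\<lambda>x. (F' x + ?Ep x) + ?LP x)"
    proof (intro cproj_add F' LP E_cproj)
      show "F' (?Ep x) = 0" for x
        by (rule orth[OF F'(1) e(2) e(3) _ F'(2) projon_in[OF N_csubsp]]) simp
      show "F' (?LP x) + ?Ep (?LP x) = 0" for x
        using orthH[OF F'(1) e(2) F'(2) lift_in] orthH[OF E_cproj e(3) projon_in[OF N_csubsp] lift_in] by simp
    qed
    have "T x = scaleR lam ((F' x + ?Ep x) + ?LP x) + ((F x + ?Ep x) + ?LQ x)" for x
    proof -
      define p q where "p = J1 x" and "q = J2 x"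
      have x: "x = projon (N 0) x + F x + F' x + ?Ep x + U (p, q)" using dec[of x] by (simp add: UJ p_def q_def)
      have l: "scaleR lam (w z) = scaleR 2 (B z) - a z" "scaleR lam (d z) = - c z" for z
        using lam by (simp_all add: w_def d_def)
      have "scaleR lam (?LP x) + ?LQ x = U (B p + scaleR ((1 + lam) / 2) p, scaleR ((1 + lam) / 2) q - B q)"
      proof -
        have h: "scaleR (1/2) (scaleR lam z + scaleR 2 (B z) - a z) + scaleR (1/2) (z + a z) = B z + scaleR ((1 + lam) / 2) z" for z
          by (simp add: scaleR_add_right scaleR_diff_right scaleR_add_left add_divide_distrib)
        have h': "scaleR (1/2) (scaleR lam z - (scaleR 2 (B z) - a z)) + scaleR (1/2) (z - a z) = scaleR ((1 + lam) / 2) z - B z" for z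
          by (simp add: scaleR_add_right scaleR_diff_right scaleR_add_left add_divide_distrib)
        have s: "scaleR lam (scaleR (1/2) z) = scaleR (1/2) (scaleR lam z)" for z :: 'k by simp
        have "scaleR lam (?LP x) + ?LQ x =
          U (scaleR (1/2) (scaleR lam p + scaleR lam (w p)) + scaleR (1/2) (p + a p)
               + (scaleR (1/2) (scaleR lam (d (u q))) + scaleR (1/2) (c (u q))),
             (scaleR (1/2) (scaleR lam (d (cadj u p))) + scaleR (1/2) (c (cadj u p)))
               + (scaleR (1/2) (scaleR lam q - scaleR lam (w q)) + scaleR (1/2) (q - a q)))"
          unfolding lift_def p_def[symmetric] q_def[symmetric] U_scaleR U_add
          by (simp only: scaleR_add_right scaleR_diff_right s add_ac)
        then show ?thesis using h[of p] h'[of q] by (simp only: l) (simp add: algebra_simps)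
      qed
      note h = this
      have "T x = F x + scaleR lam (F' x) + scaleR (1 + lam) (?Ep x)
          + U (B p + scaleR ((1 + lam) / 2) p, scaleR ((1 + lam) / 2) q - B q)"
        by (rule T_decomposition[OF x projon_in[OF N_csubsp] F(2) F'(2) projon_in[OF N_csubsp]])
      moreover have "f + scaleR lam f' + scaleR (1 + lam) e + (scaleR lam p + q)
          = scaleR lam ((f' + e) + p) + ((f + e) + q)" for f f' e p q :: 'a
        by (simp add: scaleR_add_right scaleR_add_left)
      ultimately show ?thesis by (simp only: h[symmetric])
    qed
    then show ?thesis using P Q by (auto simp: T_pairs_def fun_eq_iff)
  qed
  show ?thesis by (rule that[OF comc' cinj c_cb a_cb pair])
qed

lemma admissible_distinct:
  assumes "lam \<noteq> 1" shows "admissible (projon (N 1)) (projon (N lam))"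
  unfolding admissible_def
proof (intro conjI allI E_cproj projon_in[OF N_csubsp])
  fix x
  show "projon (N 1) (projon (N lam) x) = 0"
    by (rule projon_zero[OF N_csubsp eigsp_orth[OF T_sa _ _ projon_in[OF N_csubsp]]]) (use assms in auto)
  have "(\<Sum>mu\<in>eigs. projon (N mu) x) = projon (N 0) x + projon (N 1) x + projon (N lam) x + projon (N (1 + lam)) x"
    using lam assms by (simp add: eigs_def algebra_simps)
  then show "x = projon (N 0) x + projon (N 1) x + projon (N lam) x + projon (N (1 + lam)) x + projon H0 x"
    using decomposition[of x] by simp
qed

text \<open>On the common eigenspace any subprojection \<open>F\<close> may serve for
  \<open>Q\<close>, with the rest given to \<open>P\<close>. The choices \<open>F = 0\<close> and
  \<open>F\<close> of rank one are compared later.\<close>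

lemma admissible_equal:
  assumes l: "lam = 1" and F: "cproj F" "\<And>x. F x \<in> N 1"
  shows "admissible F (\<lambda>x. projon (N 1) x - F x)"
proof -
  let ?E = "projon (N 1)"
  have EF: "?E (F x) = F x" for x by (rule projon_fix[OF N_csubsp F(2)])
  have FE: "F (?E x) = F x" for x
    by (rule cinner_extR) (simp add: cselfadjD[OF cproj_sa[OF F(1)], symmetric] projon_selfadj[OF N_csubsp, symmetric] EF)
  note lin = cb_lin[OF cproj_cb[OF F(1)]] cb_lin[OF projon_cbounded[OF N_csubsp]]
  have "cproj (\<lambda>x. ?E x - F x)"
  proof (rule cprojI)
    show "cselfadj (\<lambda>x. ?E x - F x)" by (rule cselfadj_diff[OF cproj_sa[OF E_cproj] cproj_sa[OF F(1)]])
    show "?E (?E x - F x) - F (?E x - F x) = ?E x - F x" for x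
      by (simp add: lin EF FE cproj_idem[OF F(1)] cproj_idem[OF E_cproj])
  qed
  moreover have "F (?E x - F x) = 0" for x by (simp add: lin FE cproj_idem[OF F(1)])
  moreover have "?E x - F x \<in> N lam" for x
    using csubsp_diff[OF N_csubsp projon_in[OF N_csubsp] F(2)] l by simp
  moreover have "x = projon (N 0) x + F x + (?E x - F x) + projon (N (1 + lam)) x + projon H0 x" for x
  proof -
    have "eigs = {0, 1, 2}" unfolding eigs_def unfolding l by auto
    then have "(\<Sum>mu\<in>eigs. projon (N mu) x) = projon (N 0) x + ?E x + projon (N 2) x"
      by (simp add: algebra_simps)
    then show ?thesis using decomposition[of x] l by simp
  qed
  ultimately show ?thesis using F by (simp add: admissible_def)
qed

lemma admissible_exists: "\<exists>F F'. admissible F F'"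
proof (cases "lam = 1")
  case True
  from admissible_equal[OF True cproj_zero zero_N] show ?thesis by blast
next
  case False
  from admissible_distinct[OF False] show ?thesis by blast
qed

section \<open>The commutant of the pairs and its own commutant\<close>

lemma commuting_in_commutant_blocks: assumes X: "X \<in> commutant pair_operators" shows "X \<in> commutant_blocks"
proof (rule pairs_exist)
  fix a c
  assume comc: "\<And>X x. X \<in> commutant {B} \<Longrightarrow> X (c x) = c (X x)" and cinj: "\<And>x. c x = 0 \<Longrightarrow> x = 0"
    and c_cb: "cbounded c" and a_cb: "cbounded a"
    and pair: "\<And>F F' u. admissible F F' \<Longrightarrow> u \<in> commutant {B} \<Longrightarrow> unitary_op u \<Longrightarrow>
      \<exists>P. (P, \<lambda>x. (F x + projon (N (1 + lam)) x) + lift (\<lambda>x. scaleR (1/2) (x + a x)) (\<lambda>x. scaleR (1/2) (c (u x)))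
        (\<lambda>x. scaleR (1/2) (c (cadj u x))) (\<lambda>x. scaleR (1/2) (x - a x)) x) \<in> T_pairs T lam"
  note alin = cb_lin[OF a_cb] and clin = cb_lin[OF c_cb]
  have id_mem: "(\<lambda>x. x) \<in> commutant {B}" by (simp add: commutant_B_iff cbounded_id)
  have cadj_id: "cadj (\<lambda>x. x) = (\<lambda>x::'k. x)" by (rule cadj_selfadj[OF cselfadj_id])
  have id_unitary: "unitary_op (\<lambda>x::'k. x)" by (simp add: unitary_op_def cbounded_id cadj_id)
  let ?Ep = "projon (N (1 + lam))"
  define LQ where "LQ u = lift (\<lambda>x. scaleR (1/2) (x + a x)) (\<lambda>x. scaleR (1/2) (c (u x)))
        (\<lambda>x. scaleR (1/2) (c (cadj u x))) (\<lambda>x. scaleR (1/2) (x - a x))" for u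
  have XQ: "X ((F y + ?Ep y) + LQ u y) = (F (X y) + ?Ep (X y)) + LQ u (X y)"
    if a: "admissible F F'" "u \<in> commutant {B}" "unitary_op u" for F F' u y
  proof -
    obtain P where "(P, \<lambda>x. (F x + ?Ep x) + LQ u x) \<in> T_pairs T lam" using pair[OF a] unfolding LQ_def by blast
    then have "(\<lambda>x. (F x + ?Ep x) + LQ u x) \<in> pair_operators" by (blast dest: pair_in_pair_operators)
    from commutantD[OF X this] show ?thesis .
  qed
  obtain F F' where adm: "admissible F F'" using admissible_exists by blast
  \<comment> \<open>Stated for every \<open>Z\<close> in the commutant because it is used for
    \<open>X\<close> and for \<open>cadj X\<close>; the latter yields invariance of
    \<open>H0\<close> under \<open>X\<close>.\<close>
  have TX: "Z (T x) = T (Z x)" if Z: "Z \<in> commutant pair_operators" for Z x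
  proof -
    obtain P Q where PQ: "(P, Q) \<in> T_pairs T lam" using pair[OF adm id_mem id_unitary] by blast
    then have "P \<in> pair_operators" "Q \<in> pair_operators" by (blast dest: pair_in_pair_operators)+
    moreover have "T = (\<lambda>x. scaleR lam (P x) + Q x)" using PQ by (simp add: T_pairs_def)
    ultimately show ?thesis using commutantD[OF Z] cb_lin[OF commutant_cb[OF Z]] by simp
  qed
  have inv: "Z x \<in> N mu" if "Z \<in> commutant pair_operators" "x \<in> N mu" for Z x mu
    using TX[OF that(1), of x] that(2) by (simp add: eigsp_def cb_lin[OF commutant_cb[OF that(1)]])
  have cb: "cbounded X" by (rule commutant_cb[OF X])
  note lin = cb_lin[OF cb]
  have adjX: "cadj X \<in> commutant pair_operators"
    by (rule commutant_cadj[OF _ X]) (use pair_operators_selfadj in \<open>auto simp: cadj_selfadj cselfadj_def\<close>)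
  have "X x \<in> H0" if "x \<in> H0" for x
    by (rule generic_invariant[OF cadj'[OF cb] inv[OF adjX] that])
  from entries[OF cb this] obtain X11 X12 X21 X22 where
    c4: "cbounded X11" "cbounded X12" "cbounded X21" "cbounded X22"
    and XU: "\<And>u v. X (U (u, v)) = U (X11 u + X12 v, X21 u + X22 v)" by blast
  note l4 = c4[THEN cb_add] c4[THEN cb_diff] c4[THEN cb_scaleR] c4[THEN cb_zero] c4[THEN cb_minus]
  have t1: "X11 (B u) = B (X11 u)" "X21 (B u) = - B (X21 u)" for u
    using TX[OF X, of "U (u, 0)"] by (simp_all add: T_U XU U_inj l4 B_lin algebra_simps add_eq_0_iff)
  have t2: "X12 (B v) = - B (X12 v)" "X22 (B v) = B (X22 v)" for v
    using TX[OF X, of "U (0, v)"] by (simp_all add: T_U XU U_inj l4 B_lin algebra_simps add_eq_0_iff)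
  \<comment> \<open>An operator anticommuting with \<open>B\<close> commutes with
    \<open>B\<^sup>2\<close>, hence with \<open>B\<close>; so \<open>2 B Y = 0\<close> and
    \<open>Y\<close> vanishes by injectivity.\<close>
  have anti: "Y v = 0" if Y: "cbounded Y" "\<And>v. Y (B v) = - B (Y v)" for Y v
  proof -
    have "Y (B v) = B (Y v)" by (rule commute_sq_imp[OF Bp Y(1)]) (simp add: Y(2) B_lin)
    then have "B (Y v) = - B (Y v)" using Y(2)[of v] by simp
    then have "scaleR 2 (B (Y v)) = 0" by (simp add: scaleR_2 eq_neg_iff_add_eq_0)
    then show ?thesis using B_inj by simp
  qed
  have X12: "X12 v = 0" and X21: "X21 v = 0" for v
    using anti[OF c4(2) t2(1)] anti[OF c4(3) t1(2)] by blast+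
  have m: "X11 \<in> commutant {B}" "X22 \<in> commutant {B}" using c4 t1 t2 by (auto simp: commutant_B_iff)
  have FU: "F (U p) = 0" and EU: "?Ep (U p) = 0" for p
  proof -
    have F: "cproj F" "\<And>x. F x \<in> N 1" using adm by (auto simp: admissible_def)
    have e: "1 \<in> eigs" "1 + lam \<in> eigs" by (auto simp: eigs_def)
    show "F (U p) = 0" by (rule cproj_orth_zero[OF F(1) generic_orth[OF U_in e(1) F(2)]])
    show "?Ep (U p) = 0" by (rule projon_zero[OF N_csubsp generic_orth[OF U_in e(2)]])
  qed
  \<comment> \<open>\<open>F\<close> and \<open>?Ep\<close> vanish on \<open>H0\<close>, and
    \<open>X\<close> is already diagonal there, so this is the upper component of the commutation
    relation at \<open>U (0, v)\<close>.\<close>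
  have key: "X11 (c (u v)) = c (u (X22 v))" if u: "u \<in> commutant {B}" "unitary_op u" for u v
  proof -
    have "cbounded (cadj u)" using u cbounded_cadj by (auto simp: unitary_op_def)
    then show ?thesis
      using XQ[OF adm u, of "U (0, v)"] cb_lin[OF commutant_cb[OF u(1)]]
      by (simp add: FU EU XU LQ_def lift_U U_inj l4 X12 X21 alin clin cb_zero)
  qed
  have eq: "X22 v = X11 v" for v
  proof -
    \<comment> \<open>The phase \<open>u = I\<close> together with the commutation of
      \<open>X11\<close> and \<open>c\<close>; injectivity of \<open>c\<close> then identifies the
      entries.\<close>
    have "c (X11 v - X22 v) = 0"
      using key[OF id_mem id_unitary, of v] comc[OF m(1), of v] by (simp add: clin)
    from cinj[OF this] show ?thesis by simp
  qed
  have comu: "X11 (u v) = u (X11 v)" if u: "u \<in> commutant {B}" "unitary_op u" for u v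
  proof -
    have "c (X11 (u v) - u (X11 v)) = 0"
      using key[OF u, of v] comc[OF m(1), of "u v"] by (simp add: clin eq)
    from cinj[OF this] show ?thesis by simp
  qed
  have "X11 \<in> commutant (commutant {B})"
  proof (rule commutantI[OF c4(1)])
    fix Z x assume Z: "Z \<in> commutant {B}"
    show "X11 (Z x) = Z (X11 x)"
      by (rule commute_unitaries[OF _ c4(1) comu Z]) (auto simp: pos_op_sa[OF Bp])
  qed
  then have "diag2_on X U (commutant (commutant {B}))"
    unfolding diag2_on_def by (auto simp: XU X12 X21 eq l4)
  moreover have "scalar_on X (N mu)" if mu: "mu \<in> degen" for mu
  proof -
    have l: "lam = 1" "mu = 1" using degen_cases[OF mu] by auto
    show ?thesis unfolding l(2)
    proof (rule scalar_on_if_eigenvectors[OF N_csubsp cb])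
      fix x assume x: "x \<in> N 1"
      \<comment> \<open>The pairs belonging to \<open>F = rank_one x\<close> and
        \<open>F = 0\<close> agree in all other parts of \<open>Q\<close>, so subtracting their
        relations shows that \<open>X\<close> commutes with \<open>rank_one x\<close> at
        \<open>x\<close>.\<close>
      have "admissible (rank_one x) (\<lambda>y. projon (N 1) y - rank_one x y)"
        using x by (intro admissible_equal[OF l(1) cproj_rank_one]) (auto simp: rank_one_def intro: N_scaleC)
      from XQ[OF this id_mem id_unitary, of x] XQ[OF admissible_equal[OF l(1) cproj_zero zero_N] id_mem id_unitary, of x]
      have "X (rank_one x x) = rank_one x (X x)" by (simp add: lin add.assoc)
      then show "\<exists>c. X x = scaleC c x" unfolding rank_one_self by (auto simp: rank_one_def)
    qed
  qed
  moreover have "invariant_on X (N mu)" for mu using inv[OF X] by (simp add: invariant_on_def)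
  ultimately show ?thesis using cb by (simp add: commutant_blocks_def)
qed

lemma commutant_pair_operators: "commutant pair_operators = commutant_blocks"
  using commutant_blocks_commute commuting_in_commutant_blocks by blast

lemma algebra_blocks_commute: assumes W: "W \<in> algebra_blocks" shows "W \<in> commutant commutant_blocks"
proof (rule commutantI)
  show cb: "cbounded W" using W by (simp add: algebra_blocks_def)
  fix A x assume A: "A \<in> commutant_blocks"
  have cbA: "cbounded A" using A by (simp add: commutant_blocks_def)
  obtain W11 W12 W21 W22 where w: "W11 \<in> commutant {B}" "W12 \<in> commutant {B}" "W21 \<in> commutant {B}" "W22 \<in> commutant {B}"
    and WU: "\<And>u v. W (U (u, v)) = U (W11 u + W12 v, W21 u + W22 v)"
    using W by (auto simp: algebra_blocks_def M2_on_def)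
  obtain Y where Y: "Y \<in> commutant (commutant {B})" and AU: "\<And>u v. A (U (u, v)) = U (Y u, Y v)"
    using A by (auto simp: commutant_blocks_def diag2_on_def)
  show "W (A x) = A (W x)"
  proof (rule eq_blocks[where f = "\<lambda>x. W (A x)" and g = "\<lambda>x. A (W x)"])
    show "cbounded (\<lambda>x. W (A x))" "cbounded (\<lambda>x. A (W x))" by (rule cbounded_comp[OF cb cbA] cbounded_comp[OF cbA cb])+
    show "W (A (U (u, v))) = A (W (U (u, v)))" for u v
      by (simp add: WU AU double_commutant_B[OF Y] w cb_lin[OF commutant_cb[OF Y]])
    fix mu x assume mu: "mu \<in> eigs" and x: "x \<in> N mu"
    show "W (A x) = A (W x)"
    proof (cases "mu \<in> degen")
      case True
      then obtain k where k: "\<And>x. x \<in> N mu \<Longrightarrow> A x = scaleC k x" using A by (auto simp: commutant_blocks_def scalar_on_def)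
      have "W x \<in> N mu" using W True x by (auto simp: algebra_blocks_def invariant_on_def)
      then show ?thesis using x by (simp add: k cb_lin[OF cb])
    next
      case False
      then have "scalar_on W (N mu)" using W mu by (simp add: algebra_blocks_def)
      then obtain k where k: "\<And>x. x \<in> N mu \<Longrightarrow> W x = scaleC k x" by (auto simp: scalar_on_def)
      then show ?thesis using x commutant_blocks_invariant[OF A mu x] by (simp add: cb_lin[OF cbA])
    qed
  qed
qed

lemma zero_mem_double: "(\<lambda>x. 0) \<in> commutant (commutant {B})"
  and id_mem_double: "(\<lambda>x. x) \<in> commutant (commutant {B})"
  and B_mem_double: "B \<in> commutant (commutant {B})"
  by (rule mem_double_commutant_B; simp add: cbounded_zero cbounded_id cb_zero B_cb)+

text \<open>Each block is detected by test elements of \<open>commutant_blocks\<close>: projections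
  onto single eigenvectors force scalars, the projection onto the degenerate eigenspace forces
  invariance, and \<open>Y \<oplus> Y\<close> with \<open>Y = I\<close> and \<open>Y = B\<close>
  forces a matrix over \<open>{B}'\<close> on \<open>H0\<close>.\<close>

lemma commuting_in_algebra_blocks: assumes W: "W \<in> commutant commutant_blocks" shows "W \<in> algebra_blocks"
proof -
  have cb: "cbounded W" by (rule commutant_cb[OF W])
  note lin = cb_lin[OF cb]
  have "scalar_on W (N mu)" if mu: "mu \<in> eigs - degen" for mu
  proof (rule scalar_on_if_eigenvectors[OF N_csubsp cb])
    fix x assume x: "x \<in> N mu"
    have "rank_one x \<in> commutant_blocks" unfolding commutant_blocks_def
    proof (intro CollectI conjI ballI)
      show "cbounded (rank_one x)" by (rule cproj_cb[OF cproj_rank_one])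
      show "invariant_on (rank_one x) (N nu)" if "nu \<in> eigs - degen" for nu
        using x eigsp_orth[OF T_sa _ x, of nu] zero_N[of nu]
        by (cases "nu = mu") (auto simp: invariant_on_def rank_one_def intro: N_scaleC)
      show "scalar_on (rank_one x) (N nu)" if "nu \<in> degen" for nu
      proof -
        have "mu \<noteq> nu" using that mu by auto
        then show ?thesis using eigsp_orth[OF T_sa _ x, of nu]
          by (auto simp: scalar_on_def rank_one_def intro!: exI[of _ 0])
      qed
      show "diag2_on (rank_one x) U (commutant (commutant {B}))"
        unfolding diag2_on_def using generic_orth[OF U_in _ x] mu
        by (intro bexI[OF _ zero_mem_double]) (auto simp: rank_one_def U_zero)
    qed
    from commutantD[OF W this, of x] show "\<exists>c. W x = scaleC c x"
      unfolding rank_one_self by (auto simp: rank_one_def)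
  qed
  moreover have "invariant_on W (N mu)" if mu: "mu \<in> degen" for mu
  proof -
    have l: "lam = 1" "mu = 1" using degen_cases[OF mu] by auto
    have mu': "mu \<in> eigs" using mu degen_subset by auto
    have z: "projon (N mu) y = 0" if "nu \<noteq> mu" "y \<in> N nu" for nu y
      by (intro projon_zero[OF N_csubsp] eigsp_orth[OF T_sa _ _ that(2)]) (use that in auto)
    have "projon (N mu) \<in> commutant_blocks" unfolding commutant_blocks_def
    proof (intro CollectI conjI ballI)
      show "cbounded (projon (N mu))" by (rule projon_cbounded[OF N_csubsp])
      show "invariant_on (projon (N mu)) (N nu)" if "nu \<in> eigs - degen" for nu
      proof -
        have "nu \<noteq> mu" using that mu by auto
        then show ?thesis using z[of nu] zero_N by (simp add: invariant_on_def)
      qed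
      show "scalar_on (projon (N mu)) (N nu)" if "nu \<in> degen" for nu
        using degen_cases[OF that] l projon_fix[OF N_csubsp]
        by (auto simp: scalar_on_def scaleC_one intro!: exI[of _ 1])
      have "projon (N mu) (U p) = 0" for p
        using generic_orth[OF U_in mu'] by (intro projon_zero[OF N_csubsp]) blast
      then show "diag2_on (projon (N mu)) U (commutant (commutant {B}))"
        unfolding diag2_on_def by (intro bexI[OF _ zero_mem_double]) (auto simp: U_zero)
    qed
    from commutantD[OF W this] show ?thesis
      unfolding invariant_on_def using projon_fix[OF N_csubsp] projon_in[OF N_csubsp] by metis
  qed
  moreover have "M2_on W U (commutant {B})"
  proof -
    let ?L = "\<lambda>Y. lift Y (\<lambda>x. 0) (\<lambda>x. 0) Y"
    have L: "?L Y \<in> commutant_blocks" if Y: "Y \<in> commutant (commutant {B})" for Y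
    proof -
      have z: "?L Y x = 0" if "mu \<in> eigs" "x \<in> N mu" for mu x
        using generic_orth'[OF _ that]
        by (intro lift_orth commutant_cb[OF Y] cbounded_zero) blast
      show ?thesis unfolding commutant_blocks_def
      proof (intro CollectI conjI ballI)
        show "cbounded (?L Y)" by (intro lift_cbounded commutant_cb[OF Y] cbounded_zero)
        show "invariant_on (?L Y) (N nu)" if "nu \<in> eigs - degen" for nu
          using z[of nu] that zero_N by (auto simp: invariant_on_def)
        show "scalar_on (?L Y) (N nu)" if "nu \<in> degen" for nu
          using z[of nu] that degen_subset by (auto simp: scalar_on_def intro!: exI[of _ 0])
        show "diag2_on (?L Y) U (commutant (commutant {B}))"
          unfolding diag2_on_def using Y by (intro bexI[of _ Y]) (auto simp: lift_U)
      qed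
    qed
    have "W x \<in> H0" if "x \<in> H0" for x
    proof -
      have "x \<in> range U" using that by (simp only: U_range)
      then obtain p where "x = U p" by (rule rangeE)
      then obtain u v where x: "x = U (u, v)" by (cases p) simp
      \<comment> \<open>The lift of the identity is the projection onto \<open>H0\<close>, so
        commuting with it keeps \<open>W x\<close> inside.\<close>
      have "W x = ?L (\<lambda>x. x) (W x)"
        using commutantD[OF W L[OF id_mem_double], of x] by (simp add: x lift_U)
      then show ?thesis using lift_in[of "\<lambda>x. x" "\<lambda>x. 0" "\<lambda>x. 0" "\<lambda>x. x" "W x"] by simp
    qed
    from entries[OF cb this] obtain W11 W12 W21 W22 where
      c4: "cbounded W11" "cbounded W12" "cbounded W21" "cbounded W22"
      and WU: "\<And>u v. W (U (u, v)) = U (W11 u + W12 v, W21 u + W22 v)" by blast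
    have "W11 (B u) = B (W11 u) \<and> W21 (B u) = B (W21 u)" for u
      using commutantD[OF W L[OF B_mem_double], of "U (u, 0)"] by (simp add: lift_U WU U_inj c4 cb_zero B_lin)
    moreover have "W12 (B u) = B (W12 u) \<and> W22 (B u) = B (W22 u)" for u
      using commutantD[OF W L[OF B_mem_double], of "U (0, u)"] by (simp add: lift_U WU U_inj c4 cb_zero B_lin)
    ultimately show ?thesis unfolding M2_on_def using c4 WU
      by (intro exI[of _ W11] exI[of _ W12] exI[of _ W21] exI[of _ W22]) (simp add: commutant_B_iff)
  qed
  ultimately show ?thesis using cb by (simp add: algebra_blocks_def)
qed

section \<open>Generated von Neumann algebras as bicommutants\<close>

lemma WT_double_commutant: "WT T lam = commutant (commutant pair_operators)"
  unfolding WT_def pair_operators_def[symmetric] by (rule vN_gen_eq[OF pair_operators_selfadj])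

lemma WT_eq: "WT T lam = algebra_blocks"
  unfolding WT_double_commutant commutant_pair_operators using algebra_blocks_commute commuting_in_algebra_blocks by (intro equalityI subsetI)

lemma commutant_WT_eq: "commutant (WT T lam) = commutant_blocks"
proof -
  have "pair_operators \<subseteq> {A. cbounded A}" using pair_operators_selfadj cselfadj_cb by auto
  from triple_commutant[OF this] show ?thesis unfolding WT_double_commutant by (simp only: commutant_pair_operators)
qed

lemma vN_gen_B: "vN_gen {B} = commutant (commutant {B})"
  by (rule vN_gen_eq) (simp add: pos_op_sa[OF Bp])

end

theorem theorem2p8:
  fixes T :: "'a::chilbert \<Rightarrow> 'a" and lam :: real
    and B :: "'k::chilbert \<Rightarrow> 'k" and U :: "'k \<times> 'k \<Rightarrow> 'a"
  assumes inf_dim: "infinite_dimensional TYPE('a)"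
    and lam: "lam \<notin> {-1, 0}"
    and T_sa: "cselfadj T"
    and U: "pair_unitary U (generic_space T lam)"
    and B_pos: "cpositive B"
    and B_lower: "op_less (\<lambda>x. scaleR (\<bar>1 - \<bar>lam\<bar>\<bar> / 2) x) B"
    and B_upper: "op_less B (\<lambda>x. scaleR ((1 + \<bar>lam\<bar>) / 2) x)"
    and T0: "\<forall>x y. T (U (x, y)) - scaleR ((1 + lam) / 2) (U (x, y)) = U (B x, - B y)"
  shows "(lam = 1 \<longrightarrow>
            WT T lam = {A. cbounded A \<and> scalar_on A (eigsp T 0) \<and> invariant_on A (eigsp T 1)
                          \<and> scalar_on A (eigsp T 2) \<and> M2_on A U (commutant {B})}
          \<and> commutant (WT T lam) = {A. cbounded A \<and> invariant_on A (eigsp T 0)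
                          \<and> scalar_on A (eigsp T 1) \<and> invariant_on A (eigsp T 2)
                          \<and> diag2_on A U (vN_gen {B})})
       \<and> (lam \<notin> {-1, 0, 1} \<longrightarrow>
            WT T lam = {A. cbounded A \<and> scalar_on A (eigsp T 0) \<and> scalar_on A (eigsp T 1)
                          \<and> scalar_on A (eigsp T lam) \<and> scalar_on A (eigsp T (1 + lam))
                          \<and> M2_on A U (commutant {B})}
          \<and> commutant (WT T lam) = {A. cbounded A \<and> invariant_on A (eigsp T 0)
                          \<and> invariant_on A (eigsp T 1) \<and> invariant_on A (eigsp T lam)
                          \<and> invariant_on A (eigsp T (1 + lam)) \<and> diag2_on A U (vN_gen {B})})"
proof -
  interpret generic_part T lam B U
    using assms by unfold_locales auto
  have e1: "eigs = {0, 1, 2}" "degen = {1}" if "lam = 1"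
    unfolding eigs_def degen_def unfolding that by auto
  have e2: "eigs = {0, 1, lam, 1 + lam}" "degen = {}" if "lam \<noteq> 1"
    using that by (auto simp: eigs_def degen_def)
  show ?thesis
  proof (intro conjI impI)
    assume l: "lam = 1"
    show "WT T lam = {A. cbounded A \<and> scalar_on A (eigsp T 0) \<and> invariant_on A (eigsp T 1)
        \<and> scalar_on A (eigsp T 2) \<and> M2_on A U (commutant {B})}"
      unfolding WT_eq algebra_blocks_def e1[OF l] by auto
    show "commutant (WT T lam) = {A. cbounded A \<and> invariant_on A (eigsp T 0)
        \<and> scalar_on A (eigsp T 1) \<and> invariant_on A (eigsp T 2) \<and> diag2_on A U (vN_gen {B})}"
      unfolding commutant_WT_eq vN_gen_B commutant_blocks_def e1[OF l] by auto
  next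
    assume "lam \<notin> {-1, 0, 1}"
    then have l: "lam \<noteq> 1" by simp
    show "WT T lam = {A. cbounded A \<and> scalar_on A (eigsp T 0) \<and> scalar_on A (eigsp T 1)
        \<and> scalar_on A (eigsp T lam) \<and> scalar_on A (eigsp T (1 + lam)) \<and> M2_on A U (commutant {B})}"
      unfolding WT_eq algebra_blocks_def e2[OF l] by auto
    show "commutant (WT T lam) = {A. cbounded A \<and> invariant_on A (eigsp T 0)
        \<and> invariant_on A (eigsp T 1) \<and> invariant_on A (eigsp T lam)
        \<and> invariant_on A (eigsp T (1 + lam)) \<and> diag2_on A U (vN_gen {B})}"
      unfolding commutant_WT_eq vN_gen_B commutant_blocks_def e2[OF l] by auto
  qed
qed

end
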